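(* Let $t\le n$ and $t\le m$. For a $t$-doped POVM on $n$ data qubits with $m$ ancillas whose associated projected Heisenberg-evolved states are maximally entangled stabilizer states (in the sense defined in the context), one has $s_{\boldsymbol\mu}\le 2^n\left(\tfrac32\right)^t$.
   Context: A $t$-doped POVM: $m$ ancilla qubits in a stabilizer state $\ket\psi$, a unitary $U$ on $n+m$ qubits given by a circuit of Clifford gates and exactly $t$ gates $T=\mathrm{diag}(1,e^{i\pi/4})$, and a measurement in a stabilizer basis $\{\ket{\Phi'_b}\}$ of $n+m$ qubits; elements $\mu_b=(I\otimes\bra\psi)U^\dagger\ket{\Phi'_b}\!\bra{\Phi'_b}U(I\otimes\ket\psi)$ on $n$ qubits, and $s_{\boldsymbol\mu}=\dim\operatorname{span}\{\mu_b\}$. Gadget picture: replacing each $T$ gate acting on a qubit $q$ by a CNOT with control $q$ and target a fresh gadget qubit prepared in $\ket T=(\ket0+e^{i\pi/4}\ket1)/\sqrt2$ and projected onto $\ket0$ at the end, one obtains a Clifford circuit $\tilde U$ on $n+m+t$ qubits with $\mu_b=(I_n\otimes\bra\psi\otimes\bra{T}^{\otimes t})\tilde U^\dagger(\ket{\Phi'_b}\!\bra{\Phi'_b}\otimes\ket{0^t}\!\bra{0^t})\tilde U(I_n\otimes\ket\psi\otimes\ket T^{\otimes t})$. The associated projected Heisenberg-evolved states are the (unnormalized) vectors $(I_n\otimes\bra\psi\otimes I_t)\tilde U^\dagger(\ket{\Phi'_b}\otimes\ket{0^t})$ on $n+t$ qubits (data qubits and gadget qubits); these are (multiples of) stabilizer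 states, and the hypothesis is that the nonzero ones are maximally entangled between the $n$ data qubits and the $t$ gadget qubits. *)

theory Defs
  imports Complex_Main "Jordan_Normal_Form.Schur_Decomposition" "Jordan_Normal_Form.VS_Connect"
begin

text \<open>A register of N qubits is C^(2^N); computational basis index i < 2^N.
  Qubit q (0 \<le> q < N) is the q-th tensor factor, i.e. qubit 0 is the most
  significant bit of i.  This agrees with the Kronecker product below,
  so that C^(2^a) \<otimes> C^(2^b) has its first a qubits coming from the first factor.\<close>

definition bitq :: "nat \<Rightarrow> nat \<Rightarrow> nat \<Rightarrow> bool" where
  "bitq N q i = odd (i div 2 ^ (N - 1 - q))"

definition flipq :: "nat \<Rightarrow> nat \<Rightarrow> nat \<Rightarrow> nat" where
  "flipq N q i = (if bitq N q i then i - 2 ^ (N - 1 - q) else i + 2 ^ (N - 1 - q))"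

datatype gate = Hg nat | Sg nat | CNOTg nat nat | Tg nat

fun gate_mat :: "nat \<Rightarrow> gate \<Rightarrow> complex mat" where
  "gate_mat N (Hg q) = mat (2 ^ N) (2 ^ N) (\<lambda>(i, j).
      if i = j then (if bitq N q j then - 1 / complex_of_real (sqrt 2) else 1 / complex_of_real (sqrt 2))
      else if i = flipq N q j then 1 / complex_of_real (sqrt 2) else 0)"
| "gate_mat N (Sg q) = mat (2 ^ N) (2 ^ N) (\<lambda>(i, j).
      if i = j then (if bitq N q j then \<i> else 1) else 0)"
| "gate_mat N (Tg q) = mat (2 ^ N) (2 ^ N) (\<lambda>(i, j).
      if i = j then (if bitq N q j then cis (pi / 4) else 1) else 0)"
| "gate_mat N (CNOTg c t) = mat (2 ^ N) (2 ^ N) (\<lambda>(i, j).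
      if i = (if bitq N c j then flipq N t j else j) then 1 else 0)"

fun gate_ok :: "nat \<Rightarrow> gate \<Rightarrow> bool" where
  "gate_ok N (Hg q) = (q < N)"
| "gate_ok N (Sg q) = (q < N)"
| "gate_ok N (Tg q) = (q < N)"
| "gate_ok N (CNOTg c t) = (c < N \<and> t < N \<and> c \<noteq> t)"

fun is_T :: "gate \<Rightarrow> bool" where
  "is_T (Tg q) = True"
| "is_T _ = False"

text \<open>Unitary implemented by a circuit; the head of the list is applied first.\<close>
definition circuit_mat :: "nat \<Rightarrow> gate list \<Rightarrow> complex mat" where
  "circuit_mat N gs = foldl (\<lambda>U g. gate_mat N g * U) (1\<^sub>m (2 ^ N)) gs"

definition circuit_ok :: "nat \<Rightarrow> gate list \<Rightarrow> bool" where
  "circuit_ok N gs = list_all (gate_ok N) gs"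

definition clifford_circuit :: "nat \<Rightarrow> gate list \<Rightarrow> bool" where
  "clifford_circuit N gs = (circuit_ok N gs \<and> list_all (\<lambda>g. \<not> is_T g) gs)"

definition num_T :: "gate list \<Rightarrow> nat" where
  "num_T gs = length (filter is_T gs)"

text \<open>Gadget replacement: the k-th T gate (counting from the start value) acting on q
  becomes CNOT(q, k), k being a fresh gadget qubit.\<close>
fun gadgetize :: "nat \<Rightarrow> gate list \<Rightarrow> gate list" where
  "gadgetize k [] = []"
| "gadgetize k (Tg q # gs) = CNOTg q k # gadgetize (Suc k) gs"
| "gadgetize k (g # gs) = g # gadgetize k gs"

definition kron :: "complex mat \<Rightarrow> complex mat \<Rightarrow> complex mat" where
  "kron A B = mat (dim_row A * dim_row B) (dim_col A * dim_col B)
     (\<lambda>(i, j). A $$ (i div dim_row B, j div dim_col B) * B $$ (i mod dim_row B, j mod dim_col B))"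

definition ket_col :: "complex vec \<Rightarrow> complex mat" where
  "ket_col v = mat (dim_vec v) 1 (\<lambda>(i, j). v $ i)"

definition stabilizer_state :: "nat \<Rightarrow> complex vec \<Rightarrow> bool" where
  "stabilizer_state N \<psi> = (\<exists>C c. clifford_circuit N C \<and> cmod c = 1 \<and>
      \<psi> = c \<cdot>\<^sub>v (circuit_mat N C *\<^sub>v unit_vec (2 ^ N) 0))"

definition stab_basis_vec :: "nat \<Rightarrow> gate list \<Rightarrow> nat \<Rightarrow> complex vec" where
  "stab_basis_vec N C b = circuit_mat N C *\<^sub>v unit_vec (2 ^ N) b"

definition povm_elem :: "nat \<Rightarrow> nat \<Rightarrow> complex vec \<Rightarrow> gate list \<Rightarrow> gate list \<Rightarrow> nat \<Rightarrow> complex mat" where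
  "povm_elem n m \<psi> gs C b =
     (let V = kron (1\<^sub>m (2 ^ n)) (ket_col \<psi>);
          U = circuit_mat (n + m) gs;
          \<Phi> = ket_col (stab_basis_vec (n + m) C b)
      in mat_adjoint V * mat_adjoint U * (\<Phi> * mat_adjoint \<Phi>) * U * V)"

definition s_mu :: "nat \<Rightarrow> nat \<Rightarrow> complex vec \<Rightarrow> gate list \<Rightarrow> gate list \<Rightarrow> nat" where
  "s_mu n m \<psi> gs C =
     vectorspace.dim class_ring
       (module.span_vs class_ring (module_mat TYPE(complex) (2 ^ n) (2 ^ n))
          {povm_elem n m \<psi> gs C b | b. b < 2 ^ (n + m)})"

text \<open>Projected Heisenberg-evolved state (I_n \<otimes> <psi| \<otimes> I_t) U~^dag (|Phi'_b> \<otimes> |0^t>),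
  a 2^(n+t) x 1 matrix (data qubits first, then gadget qubits).\<close>
definition proj_state :: "nat \<Rightarrow> nat \<Rightarrow> nat \<Rightarrow> complex vec \<Rightarrow> gate list \<Rightarrow> gate list \<Rightarrow> nat \<Rightarrow> complex mat" where
  "proj_state n m t \<psi> gs C b =
     (let W = kron (kron (1\<^sub>m (2 ^ n)) (mat_adjoint (ket_col \<psi>))) (1\<^sub>m (2 ^ t));
          Ut = circuit_mat (n + m + t) (gadgetize (n + m) gs);
          \<Phi>0 = kron (ket_col (stab_basis_vec (n + m) C b)) (ket_col (unit_vec (2 ^ t) 0))
      in W * mat_adjoint Ut * \<Phi>0)"

text \<open>A (column) vector v on n data qubits followed by t gadget qubits (t \<le> n) is
  maximally entangled between the two parts iff its reduced state on the gadget
  qubits is proportional to the identity: Tr_data |v><v| = (|v|^2 / 2^t) I.\<close>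
definition max_entangled :: "nat \<Rightarrow> nat \<Rightarrow> complex mat \<Rightarrow> bool" where
  "max_entangled n t v =
     (\<forall>g < 2 ^ t. \<forall>g' < 2 ^ t.
        (\<Sum>d < 2 ^ n. v $$ (d * 2 ^ t + g, 0) * cnj (v $$ (d * 2 ^ t + g', 0)))
        = (if g = g' then (\<Sum>i < 2 ^ (n + t). complex_of_real ((cmod (v $$ (i, 0)))\<^sup>2)) / 2 ^ t else 0))"

end

theory Submission
  imports Defs
begin

text \<open>Write \<open>v\<^sub>b\<close> for the projected states. The projectors onto the stabilizer basis, pulled back
  through the Clifford circuit \<open>Ut\<close>, are combinations of the same Paulis for all \<open>b\<close>, and only
  the signs depend on \<open>b\<close>. After projection onto \<open>\<psi>\<close> this leaves a set of Paulis \<open>P \<otimes> Q\<close>,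
  independent of \<open>b\<close>, such that each of them maps \<open>v\<^sub>b\<close> to a phase times \<open>v\<^sub>b\<close> and such that their span contains
  every \<open>|v\<^sub>b><v\<^sub>b|\<close>. Contracting the gadgets with \<open>|T>\<close> kills each \<open>P \<otimes> Q\<close> in which \<open>Q\<close> has a
  tensor factor \<open>Z\<close>, since \<open><T|Z|T> = 0\<close>; so only the \<open>3^t\<close> gadget parts \<open>Q\<close> with factors in
  \<open>{I, X, Y}\<close> contribute to the POVM elements. For a fixed \<open>Q\<close>, maximal entanglement and Parseval's
  identity for Paulis, applied to the partial trace of \<open>(I \<otimes> Q)|v\<^sub>b><v\<^sub>b|\<close> over the gadgets, leave at most
  \<open>2^(n - t)\<close> choices of \<open>P\<close>. In total there are at most \<open>3^t 2^(n - t)\<close> data Paulis.\<close>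

text \<open>A circuit containing T gates does not map Paulis to Paulis, so all Pauli bookkeeping is
  done on \<open>Ut\<close>; the T phases enter only through the final contraction. The basis
  circuit \<open>C\<close> and \<open>Ut\<close> are merged into one Clifford, so that each v_b is a
  contracted column of the same matrix.

  Both factors of the bound are local to a gadget: three of the four one-qubit Paulis survive the
  contraction, and entanglement contributes the factor 1/2. The second count would usually come from
  cosets in the stabilizer group. Parseval replaces that group argument: if \<kappa> is the squared
  norm of each gadget component of v_b, the partial trace has squared Hilbert-Schmidt norm 2^t
  \<kappa>^2, so the squared Pauli coefficients add up to 2^n 2^t \<kappa>^2, while each admissible
  P accounts for (2^t \<kappa>)^2 of this. Only the moduli of phases matter, so labels with
  unspecified unit phases suffice throughout. Since the labels are common to all b, the count is
  carried out on a single nonzero v_b.\<close>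

unbundle bit_operations_syntax

subsection \<open>Bits of register indices\<close>


text \<open>A register bound becomes a statement about bits, so that closure under
  \<open>XOR\<close> and under concatenation is propositional.\<close>

lemma nat_less_exp_iff_bit: "i < 2 ^ N \<longleftrightarrow> (\<forall>k\<ge>N. \<not> bit (i::nat) k)"
proof -
  have "i < 2 ^ N \<longleftrightarrow> take_bit N i = i" by (simp add: take_bit_nat_eq_self_iff)
  also have "\<dots> \<longleftrightarrow> (\<forall>k\<ge>N. \<not> bit i k)"
    unfolding bit_eq_iff bit_take_bit_iff using not_less by auto
  finally show ?thesis .
qed

lemma xor_nat_less_exp:
  assumes "i < 2 ^ N" "j < 2 ^ N" shows "i XOR j < (2::nat) ^ N"
  using assms by (auto simp: nat_less_exp_iff_bit bit_simps)

lemma xor_nat_cancel [simp]: "(i XOR a) XOR a = (i::nat)" "a XOR (a XOR i) = i"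
  by (auto simp: bit_eq_iff bit_simps)

lemma xor_nat_eq_iff: "i = j XOR a \<longleftrightarrow> j = i XOR (a::nat)"
  by (metis xor_nat_cancel(1))

lemma bij_betw_xor:
  assumes "a < 2 ^ N" shows "bij_betw (\<lambda>i::nat. i XOR a) {..<2 ^ N} {..<2 ^ N}"
  by (rule bij_betwI[where g = "\<lambda>i. i XOR a"]) (auto intro: xor_nat_less_exp assms)

lemma sum_xor_reindex:
  fixes f :: "nat \<Rightarrow> 'a::comm_monoid_add"
  assumes "a < 2 ^ N" shows "(\<Sum>i<2 ^ N. f (i XOR a)) = (\<Sum>i<2 ^ N. f i)"
  by (rule sum.reindex_bij_betw[OF bij_betw_xor[OF assms]])

text \<open>\<open>d * 2 ^ m + e\<close> indexes a product basis vector, the trailing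
  \<open>m\<close> qubits being the low bits. The factorizations of \<open>XOR\<close>, characters
  and gates over registers rest on this.\<close>

lemma bit_concat:
  assumes "e < 2 ^ m"
  shows "bit (d * 2 ^ m + e :: nat) k = (if k < m then bit e k else bit d (k - m))"
proof (cases "k < m")
  case True
  then have "d * 2 ^ m + e = d * 2 ^ (m - k) * 2 ^ k + e" by (simp add: power_add[symmetric])
  then have "(d * 2 ^ m + e) div 2 ^ k = d * 2 ^ (m - k) + e div 2 ^ k"
    by (simp only: div_mult_self3[OF power_not_zero[OF zero_neq_numeral[symmetric]]])
  then show ?thesis using True by (simp add: bit_iff_odd)
next
  case False
  then have "(2::nat) ^ k = 2 ^ m * 2 ^ (k - m)" by (simp add: power_add[symmetric])
  then have "(d * 2 ^ m + e) div 2 ^ k = d div 2 ^ (k - m)"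
    using assms by (simp only: div_mult2_eq) simp
  then show ?thesis using False by (simp add: bit_iff_odd)
qed

lemma concat_less_exp:
  assumes "d < 2 ^ n" "e < 2 ^ m" shows "d * 2 ^ m + e < (2::nat) ^ (n + m)"
  using assms by (auto simp: nat_less_exp_iff_bit bit_concat)

lemma div_less_exp: "i < 2 ^ (n + m) \<Longrightarrow> i div 2 ^ m < (2::nat) ^ n"
  by (simp add: less_mult_imp_div_less power_add)

lemma xor_concat:
  assumes "e < 2 ^ m" "e' < 2 ^ m"
  shows "(d * 2 ^ m + e) XOR (d' * 2 ^ m + e') = (d XOR d') * 2 ^ m + (e XOR e' :: nat)"
  using assms xor_nat_less_exp[OF assms]
  by (auto simp: bit_eq_iff bit_simps bit_concat)

lemma concat_eq_iff:
  assumes "e < k" "e' < k"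
  shows "d * k + e = d' * k + e' \<longleftrightarrow> d = d' \<and> e = (e'::nat)"
proof
  assume eq: "d * k + e = d' * k + e'"
  have "(d * k + e) div k = d" "(d' * k + e') div k = d'" using assms by auto
  with eq show "d = d' \<and> e = e'" by simp
qed simp

lemma sum_concat:
  fixes f :: "nat \<Rightarrow> 'a::comm_monoid_add"
  shows "(\<Sum>i<2 ^ (n + m). f i) = (\<Sum>d<2 ^ n. \<Sum>e<2 ^ m. f (d * 2 ^ m + e))"
proof -
  have "(\<Sum>e<2 ^ m. f (d * 2 ^ m + e)) = sum f {d * 2 ^ m ..< d * 2 ^ m + 2 ^ m}" for d
    using sum.shift_bounds_nat_ivl[of f 0 "d * 2 ^ m" "2 ^ m"]
    by (simp add: add.commute lessThan_atLeast0)
  then show ?thesis by (simp add: sum.nat_group power_add)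
qed

text \<open>Qubits are counted from the most significant end and bits from the least significant
  one; hence the reflection \<open>N - 1 - q\<close> in all gate lemmas.\<close>

lemma bitq_eq_bit: "bitq N q i = bit i (N - 1 - q)"
  by (simp add: bitq_def bit_iff_odd)

lemma flipq_eq_xor: "flipq N q i = i XOR 2 ^ (N - 1 - q)"
proof -
  have "flipq N q i = flip_bit (N - 1 - q) i"
  proof (cases "bit i (N - 1 - q)")
    case True
    then have "int (unset_bit (N - 1 - q) i + 2 ^ (N - 1 - q)) = int i"
      by (simp add: of_nat_unset_bit_eq unset_bit_eq bit_simps)
    then have "unset_bit (N - 1 - q) i = i - 2 ^ (N - 1 - q)"
      unfolding of_nat_eq_iff by (metis add_diff_cancel_right')
    then show ?thesis using True by (simp add: flipq_def flip_bit_eq_if bitq_eq_bit)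
  qed (simp add: flipq_def flip_bit_eq_if bitq_eq_bit set_bit_eq)
  then show ?thesis by (simp only: flip_bit_eq_xor push_bit_of_1)
qed

subsection \<open>Pauli matrices\<close>

text \<open>The character (-1)^(c . i) of the group (Z/2)^N, with the dot product of bit strings; it
  is the eigenvalue of \<open>Z^c\<close> on the basis vector \<open>i\<close>.\<close>

definition wchar :: "nat \<Rightarrow> nat \<Rightarrow> nat \<Rightarrow> complex" where
  "wchar N c i = (\<Prod>k<N. if bit c k \<and> bit i k then -1 else 1)"

lemma wchar_commute: "wchar N c i = wchar N i c"
  by (simp add: wchar_def conj_commute)

lemma wchar_xor: "wchar N c (i XOR j) = wchar N c i * wchar N c j"
  unfolding wchar_def prod.distrib[symmetric] by (rule prod.cong) (auto simp: bit_simps)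

lemma wchar_xor_left: "wchar N (i XOR j) c = wchar N i c * wchar N j c"
  by (metis wchar_commute wchar_xor)

lemma wchar_0 [simp]: "wchar N 0 i = 1" "wchar N c 0 = 1"
  by (simp_all add: wchar_def)

lemma wchar_self [simp]: "wchar N c i * wchar N c i = 1"
  unfolding wchar_def prod.distrib[symmetric] by (rule prod.neutral) auto

lemma wchar_self_left [simp]: "wchar N c i * (wchar N c i * x) = x"
  by (simp flip: mult.assoc)

lemma cnj_wchar [simp]: "cnj (wchar N c i) = wchar N c i"
  unfolding wchar_def cnj_prod by (rule prod.cong) auto

lemma norm_wchar [simp]: "cmod (wchar N c i) = 1"
  unfolding wchar_def prod_norm[symmetric] by (rule prod.neutral) auto

lemma wchar_power2:
  assumes "k < N" shows "wchar N (2 ^ k) i = (if bit i k then -1 else 1)"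
proof -
  have "wchar N (2 ^ k) i = (\<Prod>l<N. if l = k then (if bit i k then -1 else 1) else 1)"
    unfolding wchar_def by (rule prod.cong) (auto simp: bit_simps)
  then show ?thesis using assms by simp
qed

lemma wchar_concat:
  assumes "e < 2 ^ m" "c' < 2 ^ m"
  shows "wchar (n + m) (c * 2 ^ m + c') (d * 2 ^ m + e) = wchar n c d * wchar m c' e"
proof -
  have "wchar (n + m) (c * 2 ^ m + c') (d * 2 ^ m + e) =
     (\<Prod>k<m + n. if (if k < m then bit c' k \<and> bit e k else bit c (k - m) \<and> bit d (k - m)) then -1 else 1)"
    unfolding wchar_def bit_concat[OF assms(1)] bit_concat[OF assms(2)] add.commute[of n m]
    by (rule prod.cong) auto
  also have "\<dots> = wchar m c' e * wchar n c d"
  proof -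
    have "prod f {..<m + n} = prod f {..<m} * (\<Prod>k<n. f (k + m))" for f :: "nat \<Rightarrow> complex"
      by (induction n) (simp_all add: mult.assoc add.commute)
    then show ?thesis by (simp add: wchar_def)
  qed
  finally show ?thesis by simp
qed

text \<open>Orthogonality of characters: translating \<open>c\<close> by a set bit of
  \<open>i\<close> flips every sign, so the sum equals its own negative.\<close>

lemma sum_wchar:
  assumes "i < 2 ^ N"
  shows "(\<Sum>c<2 ^ N. wchar N c i) = (if i = 0 then 2 ^ N else 0)"
proof (cases "i = 0")
  case False
  then obtain k where k: "bit i k" by (metis bit_eq_iff bit_0_eq bot_apply bot_bool_def)
  then have kN: "k < N" using assms by (metis nat_less_exp_iff_bit not_less)
  have "(\<Sum>c<2 ^ N. wchar N c i) = (\<Sum>c<2 ^ N. wchar N (c XOR 2 ^ k) i)"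
    by (rule sum_xor_reindex[symmetric]) (use kN in simp)
  also have "\<dots> = - (\<Sum>c<2 ^ N. wchar N c i)"
    using k kN by (simp add: wchar_xor_left wchar_power2 sum_negf)
  finally show ?thesis using False by simp
qed simp

text \<open>\<open>pauli N a c\<close> is \<open>X^a Z^c\<close>: the bits of \<open>a\<close> and \<open>c\<close> select the tensor factors \<open>X\<close> and \<open>Z\<close>, and
  a factor with both is \<open>Y\<close> up to a phase.\<close>

definition pauli :: "nat \<Rightarrow> nat \<Rightarrow> nat \<Rightarrow> complex mat" where
  "pauli N a c = mat (2 ^ N) (2 ^ N) (\<lambda>(i, j). if i = j XOR a then wchar N c j else 0)"

lemma pauli_carrier [simp, intro]: "pauli N a c \<in> carrier_mat (2 ^ N) (2 ^ N)"
  by (simp add: pauli_def)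

lemma pauli_dim [simp]: "dim_row (pauli N a c) = 2 ^ N" "dim_col (pauli N a c) = 2 ^ N"
  by (simp_all add: pauli_def)

lemma pauli_index:
  "i < 2 ^ N \<Longrightarrow> j < 2 ^ N \<Longrightarrow> pauli N a c $$ (i, j) = (if i = j XOR a then wchar N c j else 0)"
  by (simp add: pauli_def)

lemma mult_mat_index_sum:
  assumes "A \<in> carrier_mat n k" "B \<in> carrier_mat k m" "i < n" "j < m"
  shows "(A * B) $$ (i, j) = (\<Sum>l<k. A $$ (i, l) * B $$ (l, j))"
  using assms by (simp add: scalar_prod_def lessThan_atLeast0)

lemma pauli_mult_index:
  assumes "U \<in> carrier_mat (2 ^ N) M" "a < 2 ^ N" "i < 2 ^ N" "j < M"
  shows "(pauli N a c * U) $$ (i, j) = wchar N c (i XOR a) * U $$ (i XOR a, j)"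
proof -
  have "(pauli N a c * U) $$ (i, j) = (\<Sum>l<2 ^ N. if l = i XOR a then wchar N c l * U $$ (l, j) else 0)"
    unfolding mult_mat_index_sum[OF pauli_carrier assms(1,3,4)] using assms
    by (intro sum.cong) (auto simp: pauli_index xor_nat_eq_iff)
  then show ?thesis using xor_nat_less_exp[OF assms(3,2)] by (simp only: sum.delta[OF finite_lessThan]) simp
qed

lemma mult_pauli_index:
  assumes "U \<in> carrier_mat M (2 ^ N)" "a < 2 ^ N" "i < M" "j < 2 ^ N"
  shows "(U * pauli N a c) $$ (i, j) = U $$ (i, j XOR a) * wchar N c j"
proof -
  have "(U * pauli N a c) $$ (i, j) = (\<Sum>l<2 ^ N. if l = j XOR a then U $$ (i, l) * wchar N c j else 0)"
    unfolding mult_mat_index_sum[OF assms(1) pauli_carrier assms(3,4)] using assms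
    by (intro sum.cong) (auto simp: pauli_index)
  then show ?thesis using xor_nat_less_exp[OF assms(4,2)] by (simp only: sum.delta[OF finite_lessThan]) simp
qed

lemma pauli_concat:
  assumes "a < 2 ^ n" "a' < 2 ^ m" "c' < 2 ^ m" "d < 2 ^ n" "d' < 2 ^ n" "e < 2 ^ m" "e' < 2 ^ m"
  shows "pauli (n + m) (a * 2 ^ m + a') (c * 2 ^ m + c') $$ (d * 2 ^ m + e, d' * 2 ^ m + e') =
    pauli n a c $$ (d, d') * pauli m a' c' $$ (e, e')"
  using assms by (simp add: pauli_index concat_less_exp xor_concat concat_eq_iff xor_nat_less_exp wchar_concat)

subsection \<open>Clifford unitaries\<close>

lemma mat_adjoint_dim [simp]:
  "dim_row (mat_adjoint A) = dim_col A" "dim_col (mat_adjoint A) = dim_row A"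
  by (simp_all add: mat_adjoint_def)

lemma mat_adjoint_index:
  "i < dim_col A \<Longrightarrow> j < dim_row A \<Longrightarrow> mat_adjoint A $$ (i, j) = cnj (A $$ (j, i))"
  by (simp add: mat_adjoint_def mat_of_rows_index)

lemma mat_adjoint_carrier: "A \<in> carrier_mat n m \<Longrightarrow> mat_adjoint A \<in> carrier_mat m n"
  by (metis carrier_mat_triv carrier_matD mat_adjoint_dim)

lemma mat_adjoint_adjoint [simp]: "mat_adjoint (mat_adjoint (A :: complex mat)) = A"
  by (rule eq_matI) (simp_all add: mat_adjoint_index)

lemma mat_adjoint_mult:
  assumes "A \<in> carrier_mat n k" "B \<in> carrier_mat k m"
  shows "mat_adjoint (A * B) = mat_adjoint B * mat_adjoint (A :: complex mat)"
proof (rule eq_matI)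
  fix i j assume "i < dim_row (mat_adjoint B * mat_adjoint A)" "j < dim_col (mat_adjoint B * mat_adjoint A)"
  then have ij: "i < m" "j < n" using assms by auto
  have "(A * B) $$ (j, i) = (\<Sum>l<k. A $$ (j, l) * B $$ (l, i))"
    by (rule mult_mat_index_sum) (use assms ij in auto)
  moreover have "(mat_adjoint B * mat_adjoint A) $$ (i, j) =
      (\<Sum>l<k. mat_adjoint B $$ (i, l) * mat_adjoint A $$ (l, j))"
    by (rule mult_mat_index_sum) (use assms ij in \<open>auto intro: mat_adjoint_carrier\<close>)
  ultimately show "mat_adjoint (A * B) $$ (i, j) = (mat_adjoint B * mat_adjoint A) $$ (i, j)"
    using assms ij by (simp add: mat_adjoint_index mult.commute)
qed (use assms in auto)

text \<open>The intertwining form needs no inverse and can be checked entry by entry. The phase is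
  left free because \<open>X^a Z^c\<close> is closed under products only up to sign; later arguments
  use its modulus alone.\<close>

definition normalizes_pauli :: "nat \<Rightarrow> complex mat \<Rightarrow> bool" where
  "normalizes_pauli N U \<longleftrightarrow> (\<forall>a<2 ^ N. \<forall>c<2 ^ N. \<exists>a'<2 ^ N. \<exists>c'<2 ^ N. \<exists>ph. cmod ph = 1 \<and>
     U * pauli N a c = ph \<cdot>\<^sub>m (pauli N a' c' * U))"

text \<open>Requiring the property of the adjoint as well makes closure under adjoints immediate,
  without inverting the action on Pauli labels.\<close>

definition clifford :: "nat \<Rightarrow> complex mat \<Rightarrow> bool" where
  "clifford N U \<longleftrightarrow> U \<in> carrier_mat (2 ^ N) (2 ^ N) \<and> U * mat_adjoint U = 1\<^sub>m (2 ^ N) \<and>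
     mat_adjoint U * U = 1\<^sub>m (2 ^ N) \<and> normalizes_pauli N U \<and> normalizes_pauli N (mat_adjoint U)"

text \<open>\<open>f\<close> and \<open>g\<close> give the new X and Z labels. The last premise is
  the intertwining relation at entry (i, j), both inner sums having collapsed to one term.\<close>

lemma normalizes_pauliI:
  assumes "U \<in> carrier_mat (2 ^ N) (2 ^ N)"
    and "\<And>a c. a < 2 ^ N \<Longrightarrow> c < 2 ^ N \<Longrightarrow> f a c < 2 ^ N"
    and "\<And>a c. a < 2 ^ N \<Longrightarrow> c < 2 ^ N \<Longrightarrow> g a c < 2 ^ N"
    and "\<And>a c. a < 2 ^ N \<Longrightarrow> c < 2 ^ N \<Longrightarrow> cmod (ph a c) = 1"
    and "\<And>a c i j. a < 2 ^ N \<Longrightarrow> c < 2 ^ N \<Longrightarrow> i < 2 ^ N \<Longrightarrow> j < 2 ^ N \<Longrightarrow>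
      U $$ (i, j XOR a) * wchar N c j =
      ph a c * (wchar N (g a c) (i XOR f a c) * U $$ (i XOR f a c, j))"
  shows "normalizes_pauli N U"
  unfolding normalizes_pauli_def
proof (intro allI impI)
  fix a c :: nat assume ac: "a < 2 ^ N" "c < 2 ^ N"
  have "U * pauli N a c = ph a c \<cdot>\<^sub>m (pauli N (f a c) (g a c) * U)"
  proof (rule eq_matI)
    fix i j assume "i < dim_row (ph a c \<cdot>\<^sub>m (pauli N (f a c) (g a c) * U))"
      "j < dim_col (ph a c \<cdot>\<^sub>m (pauli N (f a c) (g a c) * U))"
    then have ij: "i < 2 ^ N" "j < 2 ^ N" using assms(1) by auto
    then show "(U * pauli N a c) $$ (i, j) = (ph a c \<cdot>\<^sub>m (pauli N (f a c) (g a c) * U)) $$ (i, j)"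
      using assms(5)[OF ac ij] ac assms(1) carrier_matD[OF assms(1)]
      by (simp add: pauli_mult_index[OF assms(1) assms(2)[OF ac]] mult_pauli_index[OF assms(1)] del: index_mult_mat(1))
  qed (use assms(1) in auto)
  then show "\<exists>a'<2 ^ N. \<exists>c'<2 ^ N. \<exists>ph. cmod ph = 1 \<and> U * pauli N a c = ph \<cdot>\<^sub>m (pauli N a' c' * U)"
    using assms(2-4)[OF ac] by blast
qed

lemma clifford_carrier: "clifford N U \<Longrightarrow> U \<in> carrier_mat (2 ^ N) (2 ^ N)"
  by (simp add: clifford_def)

lemma clifford_adjoint: "clifford N U \<Longrightarrow> clifford N (mat_adjoint U)"
  by (auto simp: clifford_def intro: mat_adjoint_carrier)

lemma normalizes_pauli_mult:
  assumes U: "U \<in> carrier_mat (2 ^ N) (2 ^ N)" and V: "V \<in> carrier_mat (2 ^ N) (2 ^ N)"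
    and "normalizes_pauli N U" "normalizes_pauli N V"
  shows "normalizes_pauli N (U * V)"
  unfolding normalizes_pauli_def
proof (intro allI impI)
  fix a c :: nat assume "a < 2 ^ N" "c < 2 ^ N"
  with assms(4) obtain a1 c1 p1 where 1: "a1 < 2 ^ N" "c1 < 2 ^ N" "cmod p1 = 1"
    "V * pauli N a c = p1 \<cdot>\<^sub>m (pauli N a1 c1 * V)" unfolding normalizes_pauli_def by blast
  with assms(3) obtain a2 c2 p2 where 2: "a2 < 2 ^ N" "c2 < 2 ^ N" "cmod p2 = 1"
    "U * pauli N a1 c1 = p2 \<cdot>\<^sub>m (pauli N a2 c2 * U)" unfolding normalizes_pauli_def by blast
  have "U * V * pauli N a c = U * (p1 \<cdot>\<^sub>m (pauli N a1 c1 * V))"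
    using assoc_mult_mat[OF U V pauli_carrier] 1 by simp
  also have "\<dots> = p1 \<cdot>\<^sub>m (U * (pauli N a1 c1 * V))"
    by (rule mult_smult_distrib) (use U V in auto)
  also have "\<dots> = p1 \<cdot>\<^sub>m (U * pauli N a1 c1 * V)"
    using assoc_mult_mat[OF U pauli_carrier V] by simp
  also have "\<dots> = p1 \<cdot>\<^sub>m (p2 \<cdot>\<^sub>m (pauli N a2 c2 * U * V))"
    unfolding 2 by (subst mult_smult_assoc_mat[OF mult_carrier_mat[OF pauli_carrier U] V]) (rule refl)
  also have "\<dots> = (p1 * p2) \<cdot>\<^sub>m (pauli N a2 c2 * (U * V))"
    using assoc_mult_mat[OF pauli_carrier U V] by (auto simp: mult.assoc intro!: eq_matI)
  finally have "U * V * pauli N a c = (p1 * p2) \<cdot>\<^sub>m (pauli N a2 c2 * (U * V))" .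
  then show "\<exists>a'<2 ^ N. \<exists>c'<2 ^ N. \<exists>ph. cmod ph = 1 \<and> U * V * pauli N a c = ph \<cdot>\<^sub>m (pauli N a' c' * (U * V))"
    using 1 2 by (intro exI[of _ a2] conjI exI[of _ c2] exI[of _ "p1 * p2"]) (auto simp: norm_mult)
qed

lemma mult_inverse_pair:
  fixes A B A' B' :: "complex mat"
  assumes "A \<in> carrier_mat k k" "B \<in> carrier_mat k k" "A' \<in> carrier_mat k k" "B' \<in> carrier_mat k k"
    and "A * A' = 1\<^sub>m k" "B * B' = 1\<^sub>m k"
  shows "A * B * (B' * A') = 1\<^sub>m k"
proof -
  have "A * B * (B' * A') = A * (B * (B' * A'))"
    by (rule assoc_mult_mat) (use assms in auto)
  also have "B * (B' * A') = B * B' * A'"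
    by (rule assoc_mult_mat[symmetric]) (use assms in auto)
  finally show ?thesis using assms by (simp add: left_mult_one_mat[OF assms(3)] assms)
qed

lemma clifford_mult:
  assumes "clifford N U" "clifford N V" shows "clifford N (U * V)"
proof -
  note c = clifford_carrier[OF assms(1)] clifford_carrier[OF assms(2)]
  note ca = mat_adjoint_carrier[OF c(1)] mat_adjoint_carrier[OF c(2)]
  show ?thesis
    using assms c ca unfolding clifford_def mat_adjoint_mult[OF c]
    by (auto intro!: mult_inverse_pair normalizes_pauli_mult)
qed

lemma clifford_one: "clifford N (1\<^sub>m (2 ^ N))"
proof -
  have *: "mat_adjoint (1\<^sub>m (2 ^ N)) = (1\<^sub>m (2 ^ N) :: complex mat)"
    by (rule eq_matI) (auto simp: mat_adjoint_index)
  have "normalizes_pauli N (1\<^sub>m (2 ^ N))"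
    by (rule normalizes_pauliI[where f = "\<lambda>a c. a" and g = "\<lambda>a c. c" and ph = "\<lambda>a c. 1"])
      (auto simp: xor_nat_less_exp)
  then show ?thesis by (simp add: clifford_def *)
qed

section \<open>The generators S, CNOT and H\<close>

lemma power2_less_exp: "k < N \<Longrightarrow> (2::nat) ^ k < 2 ^ N"
  by simp

text \<open>Parametrized by \<open>z\<close> so that S and its adjoint, with \<open>z\<close> equal
  to \<i> and -\<i>, are treated together.\<close>

definition diag_gate :: "nat \<Rightarrow> nat \<Rightarrow> complex \<Rightarrow> complex mat" where
  "diag_gate N k z = mat (2 ^ N) (2 ^ N) (\<lambda>(i, j). if i = j then (if bit j k then z else 1) else 0)"

text \<open>Moving the gate past X on qubit \<open>k\<close> produces \<open>z\<close> times X Z: on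
  the two basis states this is \<open>z = z * 1\<close> and \<open>1 = z * (-1) * z\<close>. Hence
  the Z label toggles exactly when the X label has bit \<open>k\<close>.\<close>

lemma diag_gate_normalizes:
  assumes "k < N" "z\<^sup>2 = -1"
  shows "normalizes_pauli N (diag_gate N k z)"
proof (rule normalizes_pauliI[where f = "\<lambda>a c. a" and g = "\<lambda>a c. if bit a k then c XOR 2 ^ k else c"
      and ph = "\<lambda>a c. if bit a k then z else 1"])
  have z: "z * z = -1" "cmod z = 1" using assms(2)
    by (auto simp: power2_eq_square) (metis norm_minus_cancel norm_one norm_power power2_eq_square assms(2) norm_ge_zero power_one power2_eq_imp_eq zero_le_one)
  show "cmod (if bit a k then z else 1) = 1" for a :: nat using z by simp
  fix a c :: nat assume ac: "a < 2 ^ N" "c < 2 ^ N"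
  show "a < 2 ^ N" by fact
  show "(if bit a k then c XOR 2 ^ k else c) < 2 ^ N"
    using ac power2_less_exp[OF assms(1)] by (simp add: xor_nat_less_exp)
  fix i j :: nat assume ij: "i < 2 ^ N" "j < 2 ^ N"
  show "diag_gate N k z $$ (i, j XOR a) * wchar N c j =
    (if bit a k then z else 1) * (wchar N (if bit a k then c XOR 2 ^ k else c) (i XOR a) * diag_gate N k z $$ (i XOR a, j))"
  proof (cases "i = j XOR a")
    case True
    then show ?thesis using ij ac assms(1) z
      by (auto simp: diag_gate_def xor_nat_less_exp bit_simps wchar_xor_left wchar_power2)
  next
    case False
    then have "i XOR a \<noteq> j" by (metis xor_nat_cancel(1))
    then show ?thesis using False ij ac by (simp add: diag_gate_def xor_nat_less_exp)
  qed
qed (simp add: diag_gate_def)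

lemma diag_gate_adjoint: "mat_adjoint (diag_gate N k z) = diag_gate N k (cnj z)"
  by (rule eq_matI) (auto simp: mat_adjoint_index diag_gate_def)

lemma diag_gate_mult: "diag_gate N k z * diag_gate N k w = diag_gate N k (z * w)"
proof (rule eq_matI)
  fix i j assume "i < dim_row (diag_gate N k (z * w))" "j < dim_col (diag_gate N k (z * w))"
  then have ij: "i < 2 ^ N" "j < 2 ^ N" by (auto simp: diag_gate_def)
  have "(diag_gate N k z * diag_gate N k w) $$ (i, j) = (\<Sum>l<2 ^ N. diag_gate N k z $$ (i, l) * diag_gate N k w $$ (l, j))"
    by (rule mult_mat_index_sum) (use ij in \<open>auto simp: diag_gate_def\<close>)
  also have "\<dots> = (\<Sum>l<2 ^ N. if l = j then diag_gate N k z $$ (i, j) * diag_gate N k w $$ (j, j) else 0)"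
    by (rule sum.cong) (use ij in \<open>auto simp: diag_gate_def\<close>)
  finally show "(diag_gate N k z * diag_gate N k w) $$ (i, j) = diag_gate N k (z * w) $$ (i, j)"
    using ij by (auto simp: diag_gate_def)
qed (auto simp: diag_gate_def)

lemma clifford_S:
  assumes "q < N" shows "clifford N (gate_mat N (Sg q))"
proof -
  have S: "gate_mat N (Sg q) = diag_gate N (N - 1 - q) \<i>"
    unfolding gate_mat.simps diag_gate_def bitq_eq_bit ..
  have one: "diag_gate N k 1 = 1\<^sub>m (2 ^ N)" for k
    by (rule eq_matI) (auto simp: diag_gate_def)
  show ?thesis unfolding S clifford_def diag_gate_adjoint diag_gate_mult
    using assms by (auto simp: one intro!: diag_gate_normalizes) (simp add: diag_gate_def)
qed

lemma clifford_selfadjointI: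
  assumes "U \<in> carrier_mat (2 ^ N) (2 ^ N)" "normalizes_pauli N U" "mat_adjoint U = U" "U * U = 1\<^sub>m (2 ^ N)"
  shows "clifford N U"
  using assms by (simp add: clifford_def)

definition cnot_map :: "nat \<Rightarrow> nat \<Rightarrow> nat \<Rightarrow> nat" where
  "cnot_map k l j = (if bit j k then j XOR 2 ^ l else j)"

lemma gate_mat_CNOT:
  "gate_mat N (CNOTg q r) = mat (2 ^ N) (2 ^ N)
     (\<lambda>(i, j). if i = cnot_map (N - 1 - q) (N - 1 - r) j then 1 else 0)"
  unfolding gate_mat.simps cnot_map_def bitq_eq_bit flipq_eq_xor ..

lemma cnot_map_less: "l < N \<Longrightarrow> j < 2 ^ N \<Longrightarrow> cnot_map k l j < 2 ^ N"
  by (simp add: cnot_map_def xor_nat_less_exp)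

lemma cnot_map_involution: "k \<noteq> l \<Longrightarrow> cnot_map k l (cnot_map k l j) = j"
  by (auto simp: cnot_map_def bit_simps)

lemma cnot_map_xor: "cnot_map k l (i XOR j) = cnot_map k l i XOR cnot_map k l j"
  by (rule bit_eqI) (auto simp: cnot_map_def bit_simps)

text \<open>CNOT permutes basis indices by a map linear over Z/2. X labels follow this map and Z
  labels follow its transpose, which is the same map with control and target exchanged; no phase
  arises.\<close>

lemma clifford_CNOT:
  assumes "q < N" "r < N" "q \<noteq> r" shows "clifford N (gate_mat N (CNOTg q r))"
proof -
  define k l where "k = N - 1 - q" and "l = N - 1 - r"
  have kl: "k < N" "l < N" "k \<noteq> l" using assms by (auto simp: k_def l_def)
  note inv = cnot_map_involution[OF kl(3)]
  define U where "U = gate_mat N (CNOTg q r)"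
  have U: "U = mat (2 ^ N) (2 ^ N) (\<lambda>(i, j). if i = cnot_map k l j then 1 else 0)"
    unfolding U_def gate_mat_CNOT k_def l_def ..
  have "clifford N U"
  proof (rule clifford_selfadjointI)
    show "U \<in> carrier_mat (2 ^ N) (2 ^ N)" by (simp add: U)
    show "mat_adjoint U = U"
      by (rule eq_matI) (auto simp: U mat_adjoint_index inv)
    show "U * U = 1\<^sub>m (2 ^ N)"
    proof (rule eq_matI)
      fix i j assume "i < dim_row (1\<^sub>m (2 ^ N) :: complex mat)" "j < dim_col (1\<^sub>m (2 ^ N) :: complex mat)"
      then have ij: "i < 2 ^ N" "j < 2 ^ N" by auto
      have "(U * U) $$ (i, j) = (\<Sum>m<2 ^ N. U $$ (i, m) * U $$ (m, j))"
        by (rule mult_mat_index_sum) (use ij in \<open>auto simp: U\<close>)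
      also have "\<dots> = (\<Sum>m<2 ^ N. if m = cnot_map k l j then of_bool (i = j) else 0)"
        by (rule sum.cong) (use ij in \<open>auto simp: U inv\<close>)
      finally show "(U * U) $$ (i, j) = 1\<^sub>m (2 ^ N) $$ (i, j)"
        using ij cnot_map_less[OF kl(2)] by simp
    qed (auto simp: U)
    show "normalizes_pauli N U"
    proof (rule normalizes_pauliI[where ph = "\<lambda>a c. 1" and f = "\<lambda>a c. cnot_map k l a"
          and g = "\<lambda>a c. cnot_map l k c"])
      fix a c :: nat assume ac: "a < 2 ^ N" "c < 2 ^ N"
      show a': "cnot_map k l a < 2 ^ N" using kl ac cnot_map_less by blast
      show "cnot_map l k c < 2 ^ N" using kl ac cnot_map_less by blast
      fix i j :: nat assume ij: "i < 2 ^ N" "j < 2 ^ N"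
      show "U $$ (i, j XOR a) * wchar N c j =
        1 * (wchar N (cnot_map l k c) (i XOR cnot_map k l a) * U $$ (i XOR cnot_map k l a, j))"
      proof (cases "i = cnot_map k l j XOR cnot_map k l a")
        case True
        have "wchar N (cnot_map l k c) (cnot_map k l j) = wchar N c j"
          using kl by (auto simp: cnot_map_def wchar_xor wchar_xor_left wchar_power2 bit_simps
              wchar_commute[of N _ "2 ^ l"] wchar_commute[of N c])
        then show ?thesis using True ij ac a' by (simp add: U xor_nat_less_exp cnot_map_xor cnot_map_less kl)
      next
        case False
        then have "i XOR cnot_map k l a \<noteq> cnot_map k l j" by (metis xor_nat_cancel(1))
        then show ?thesis using False ij ac a' by (simp add: U xor_nat_less_exp cnot_map_xor)
      qed
    qed (auto simp: U)
  qed
  then show ?thesis by (simp only: U_def)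
qed

lemma clifford_H:
  assumes "q < N" shows "clifford N (gate_mat N (Hg q))"
proof -
  define k where "k = N - 1 - q"
  define s where "s = 1 / complex_of_real (sqrt 2)"
  have k: "k < N" "(2::nat) ^ k < 2 ^ N" using assms by (auto simp: k_def)
  have ss: "s * s = 1 / 2" by (simp add: s_def flip: of_real_mult)
  define U where "U = gate_mat N (Hg q)"
  have U: "U = mat (2 ^ N) (2 ^ N) (\<lambda>(i, j). if i = j then (if bit j k then - s else s)
      else if i = j XOR 2 ^ k then s else 0)"
    unfolding U_def gate_mat.simps bitq_eq_bit flipq_eq_xor k_def s_def minus_divide_left ..
  have ne: "j XOR 2 ^ k \<noteq> j" "j \<noteq> j XOR 2 ^ k" for j :: nat
    by (auto simp: bit_eq_iff bit_simps)
  have "clifford N U"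
  proof (rule clifford_selfadjointI)
    show c: "U \<in> carrier_mat (2 ^ N) (2 ^ N)" by (simp add: U)
    show "mat_adjoint U = U"
      by (rule eq_matI) (auto simp: U mat_adjoint_index s_def)
    show "U * U = 1\<^sub>m (2 ^ N)"
    proof (rule eq_matI)
      fix i j assume "i < dim_row (1\<^sub>m (2 ^ N) :: complex mat)" "j < dim_col (1\<^sub>m (2 ^ N) :: complex mat)"
      then have ij: "i < 2 ^ N" "j < 2 ^ N" by auto
      have "(U * U) $$ (i, j) = (\<Sum>m<2 ^ N. U $$ (i, m) * U $$ (m, j))"
        by (rule mult_mat_index_sum) (use ij in \<open>auto simp: U\<close>)
      also have "\<dots> = (\<Sum>m<2 ^ N. (if m = j then U $$ (i, j) * U $$ (j, j) else 0) +
          (if m = j XOR 2 ^ k then U $$ (i, j XOR 2 ^ k) * U $$ (j XOR 2 ^ k, j) else 0))"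
        by (rule sum.cong) (use ij ne in \<open>auto simp: U\<close>)
      also have "\<dots> = U $$ (i, j) * U $$ (j, j) + U $$ (i, j XOR 2 ^ k) * U $$ (j XOR 2 ^ k, j)"
        using ij k by (simp add: sum.distrib xor_nat_less_exp)
      also have "\<dots> = 1\<^sub>m (2 ^ N) $$ (i, j)"
        using ij k ne by (auto simp: U xor_nat_less_exp ss bit_simps)
      finally show "(U * U) $$ (i, j) = 1\<^sub>m (2 ^ N) $$ (i, j)" .
    qed (auto simp: U)
    \<comment> \<open>\<open>XOR\<close> with \<open>b a c\<close> exchanges bit \<open>k\<close> of
      \<open>a\<close> with that of \<open>c\<close>, as H exchanges X and Z: it changes both bits
      exactly when they differ. The sign used below is that of H XZ H = ZX = -XZ.\<close>
    define b where "b = (\<lambda>(a::nat) (c::nat). if bit a k = bit c k then 0 else 2 ^ k :: nat)"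
    show "normalizes_pauli N U"
    proof (rule normalizes_pauliI[where ph = "\<lambda>a c. if bit a k \<and> bit c k then -1 else 1"
          and f = "\<lambda>a c. a XOR b a c" and g = "\<lambda>a c. c XOR b a c"])
      fix a c :: nat assume ac: "a < 2 ^ N" "c < 2 ^ N"
      have b: "b a c < 2 ^ N" using k by (simp add: b_def)
      then show ab: "a XOR b a c < 2 ^ N" "c XOR b a c < 2 ^ N"
        using ac by (auto intro: xor_nat_less_exp)
      fix i j :: nat assume ij: "i < 2 ^ N" "j < 2 ^ N"
      have Ui: "U $$ (x, y) = (if x = y then (if bit y k then - s else s)
         else if x = y XOR 2 ^ k then s else 0)" if "x < 2 ^ N" "y < 2 ^ N" for x y
        using that by (simp add: U)
      consider (1) "i = j XOR a" | (2) "i = (j XOR a) XOR 2 ^ k"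
        | (3) "i \<noteq> j XOR a" "i \<noteq> (j XOR a) XOR 2 ^ k" by blast
      then show "U $$ (i, j XOR a) * wchar N c j = (if bit a k \<and> bit c k then -1 else 1) *
        (wchar N (c XOR b a c) (i XOR (a XOR b a c)) * U $$ (i XOR (a XOR b a c), j))"
      proof cases
        case 1
        then have "i XOR (a XOR b a c) = j XOR b a c"
          by (auto simp: bit_eq_iff bit_simps)
        then show ?thesis using 1 ij ac b ne k
          by (auto simp: Ui xor_nat_less_exp wchar_xor wchar_xor_left wchar_power2 bit_simps b_def
              wchar_commute[of N c "2 ^ k"])
      next
        case 2
        then have "i XOR (a XOR b a c) = (j XOR b a c) XOR 2 ^ k"
          by (auto simp: bit_eq_iff bit_simps)
        then show ?thesis using 2 ij ac b ne k
          by (auto simp: Ui xor_nat_less_exp wchar_xor wchar_xor_left wchar_power2 bit_simps b_def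
              wchar_commute[of N c "2 ^ k"])
      next
        case 3
        have "i XOR (a XOR b a c) \<noteq> j" "i XOR (a XOR b a c) \<noteq> j XOR 2 ^ k"
          using 3 by (auto simp: b_def bit_eq_iff bit_simps split: if_splits)
        then show ?thesis using 3 ij ac ab by (simp add: Ui xor_nat_less_exp)
      qed
    qed (auto simp: U)
  qed
  then show ?thesis by (simp only: U_def)
qed

lemma clifford_gate: "gate_ok N g \<Longrightarrow> \<not> is_T g \<Longrightarrow> clifford N (gate_mat N g)"
  by (cases g) (simp_all del: gate_mat.simps add: clifford_H clifford_S clifford_CNOT)

lemma gate_mat_carrier [simp]: "gate_mat N g \<in> carrier_mat (2 ^ N) (2 ^ N)"
  by (cases g) simp_all

lemma circuit_mat_Nil [simp]: "circuit_mat N [] = 1\<^sub>m (2 ^ N)"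
  by (simp add: circuit_mat_def)

lemma circuit_mat_snoc [simp]: "circuit_mat N (gs @ [g]) = gate_mat N g * circuit_mat N gs"
  by (simp add: circuit_mat_def)

lemma circuit_mat_carrier [simp]: "circuit_mat N gs \<in> carrier_mat (2 ^ N) (2 ^ N)"
  by (induction gs rule: rev_induct) (auto intro: mult_carrier_mat[OF gate_mat_carrier])

text \<open>\<open>gadgetize\<close> recurses from the gate applied first, whereas the matrix grows
  at the gate applied last; this form lets inductions peel off the first gate.\<close>

lemma circuit_mat_Cons: "circuit_mat N (g # gs) = circuit_mat N gs * gate_mat N g"
proof (induction gs rule: rev_induct)
  case Nil
  then show ?case using circuit_mat_snoc[of N "[]" g]
    by (simp add: right_mult_one_mat[OF gate_mat_carrier] left_mult_one_mat[OF gate_mat_carrier])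
next
  case (snoc h gs)
  then show ?case
    using circuit_mat_snoc[of N "g # gs" h]
    by (simp add: assoc_mult_mat[OF gate_mat_carrier circuit_mat_carrier gate_mat_carrier])
qed

lemma clifford_circuit_mat: "clifford_circuit N gs \<Longrightarrow> clifford N (circuit_mat N gs)"
  by (induction gs rule: rev_induct)
    (auto simp: clifford_circuit_def circuit_ok_def clifford_one intro!: clifford_mult clifford_gate)

subsection \<open>Gadgets\<close>

lemma bit_register:
  assumes "q < N" "g < 2 ^ t"
  shows "bit (x * 2 ^ t + g :: nat) (N + t - 1 - q) = bit x (N - 1 - q)"
proof -
  have "N + t - 1 - q = t + (N - 1 - q)" using assms(1) by simp
  then show ?thesis by (simp only: bit_concat[OF assms(2)]) simp
qed

lemma xor_register:
  assumes "q < N" "g < 2 ^ t"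
  shows "(x * 2 ^ t + g) XOR 2 ^ (N + t - 1 - q) = (x XOR 2 ^ (N - 1 - q)) * 2 ^ t + (g :: nat)"
proof -
  have "N + t - 1 - q = (N - 1 - q) + t" using assms(1) by simp
  then have "(2::nat) ^ (N + t - 1 - q) = 2 ^ (N - 1 - q) * 2 ^ t + 0"
    by (simp only: power_add)
  then show ?thesis using xor_concat[OF assms(2), of 0] by simp
qed

text \<open>Because qubits are numbered from the most significant end, appending \<open>t\<close>
  qubits does not rename the first \<open>N\<close>: the gate becomes G \<otimes> I.\<close>

lemma gate_mat_embed:
  assumes "gate_ok N G" "z < 2 ^ N" "x < 2 ^ N" "h < 2 ^ t" "g < 2 ^ t"
  shows "gate_mat (N + t) G $$ (z * 2 ^ t + h, x * 2 ^ t + g) =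
    (if h = g then gate_mat N G $$ (z, x) else 0)"
  using assms
  by (cases G) (simp_all add: concat_less_exp bitq_eq_bit flipq_eq_xor concat_eq_iff
      bit_register[unfolded diff_diff_left plus_1_eq_Suc] xor_register[unfolded diff_diff_left plus_1_eq_Suc])

lemma circuit_mat_embed:
  assumes "circuit_ok N gs" "z < 2 ^ N" "x < 2 ^ N" "h < 2 ^ t" "g < 2 ^ t"
  shows "circuit_mat (N + t) gs $$ (z * 2 ^ t + h, x * 2 ^ t + g) =
    (if h = g then circuit_mat N gs $$ (z, x) else 0)"
  using assms
proof (induction gs arbitrary: z h rule: rev_induct)
  case Nil
  then show ?case by (simp add: concat_less_exp concat_eq_iff)
next
  case (snoc G gs)
  then have ok: "gate_ok N G" "circuit_ok N gs" by (auto simp: circuit_ok_def)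
  have "circuit_mat (N + t) (gs @ [G]) $$ (z * 2 ^ t + h, x * 2 ^ t + g) =
    (\<Sum>l<2 ^ (N + t). gate_mat (N + t) G $$ (z * 2 ^ t + h, l) * circuit_mat (N + t) gs $$ (l, x * 2 ^ t + g))"
    unfolding circuit_mat_snoc using snoc.prems
    by (intro mult_mat_index_sum[OF gate_mat_carrier circuit_mat_carrier]) (auto intro: concat_less_exp)
  also have "\<dots> = (\<Sum>l<2 ^ N. \<Sum>k<2 ^ t. if k = h then
      (if h = g then gate_mat N G $$ (z, l) * circuit_mat N gs $$ (l, x) else 0) else 0)"
    unfolding sum_concat using snoc ok by (intro sum.cong) (auto simp: gate_mat_embed)
  also have "\<dots> = (if h = g then \<Sum>l<2 ^ N. gate_mat N G $$ (z, l) * circuit_mat N gs $$ (l, x) else 0)"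
    using snoc.prems by simp
  also have "(\<Sum>l<2 ^ N. gate_mat N G $$ (z, l) * circuit_mat N gs $$ (l, x)) = circuit_mat N (gs @ [G]) $$ (z, x)"
    unfolding circuit_mat_snoc using snoc.prems
    by (intro mult_mat_index_sum[OF gate_mat_carrier circuit_mat_carrier, symmetric])
  finally show ?case .
qed

text \<open>The amplitude of t copies of |T> at basis index \<open>g\<close>, without the
  normalisation 2^(-t/2).\<close>

definition tphase :: "nat \<Rightarrow> nat \<Rightarrow> complex" where
  "tphase t g = (\<Prod>k<t. if bit g k then cis (pi / 4) else 1)"

lemma tphase_0 [simp]: "tphase t 0 = 1"
  by (simp add: tphase_def)

lemma tphase_remove:
  assumes "k < t"
  shows "tphase t g = (if bit g k then cis (pi / 4) else 1) *
    (\<Prod>l\<in>{..<t} - {k}. if bit g l then cis (pi / 4) else 1)"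
  unfolding tphase_def using assms by (subst prod.remove[of _ k]) auto

lemma tphase_xor:
  assumes "k < t" "\<not> bit g k" shows "tphase t (g XOR 2 ^ k) = cis (pi / 4) * tphase t g"
proof -
  have "(\<Prod>l\<in>{..<t} - {k}. if bit (g XOR 2 ^ k) l then cis (pi / 4) else 1) =
        (\<Prod>l\<in>{..<t} - {k}. if bit g l then cis (pi / 4) else 1)"
    by (rule prod.cong) (auto simp: bit_simps)
  moreover have "bit (g XOR 2 ^ k) k" using assms by (auto simp: bit_simps)
  ultimately show ?thesis
    using assms by (simp add: tphase_remove[OF assms(1)])
qed

lemma clifford_gadgetize:
  assumes "circuit_ok N gs" "k + num_T gs \<le> t"
  shows "clifford_circuit (N + t) (gadgetize (N + k) gs)"
  using assms
proof (induction gs arbitrary: k)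
  case (Cons G gs)
  then show ?case
    using Cons.IH[of "Suc k"] Cons.IH[of k]
    by (cases G) (auto simp: clifford_circuit_def circuit_ok_def num_T_def)
qed (simp add: clifford_circuit_def circuit_ok_def)

lemma circuit_mat_Cons_index:
  assumes "i < 2 ^ N" "j < 2 ^ N"
  shows "circuit_mat N (g # gs) $$ (i, j) = (\<Sum>l<2 ^ N. circuit_mat N gs $$ (i, l) * gate_mat N g $$ (l, j))"
  unfolding circuit_mat_Cons
  by (rule mult_mat_index_sum[OF circuit_mat_carrier gate_mat_carrier assms])

lemma circuit_mat_Cons_index_embed:
  assumes "gate_ok N G" "i < 2 ^ (N + t)" "x < 2 ^ N" "g < 2 ^ t"
  shows "circuit_mat (N + t) (G # gs) $$ (i, x * 2 ^ t + g) =
    (\<Sum>z<2 ^ N. circuit_mat (N + t) gs $$ (i, z * 2 ^ t + g) * gate_mat N G $$ (z, x))"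
proof -
  have "circuit_mat (N + t) (G # gs) $$ (i, x * 2 ^ t + g) = (\<Sum>z<2 ^ N. \<Sum>k<2 ^ t.
    if k = g then circuit_mat (N + t) gs $$ (i, z * 2 ^ t + g) * gate_mat N G $$ (z, x) else 0)"
    unfolding circuit_mat_Cons_index[OF assms(2) concat_less_exp[OF assms(3,4)]] sum_concat
    using assms by (intro sum.cong) (auto simp: gate_mat_embed)
  then show ?thesis using assms(4) by simp
qed

text \<open>A CNOT permutes basis vectors, so prepending it merely relabels the column. Its control
  lies in the leading register, which therefore stays fixed.\<close>

lemma circuit_mat_Cons_gadget:
  assumes "q < N" "k < t" "i < 2 ^ (N + t)" "x < 2 ^ N" "g < 2 ^ t"
  shows "circuit_mat (N + t) (CNOTg q (N + k) # gs) $$ (i, x * 2 ^ t + g) =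
    circuit_mat (N + t) gs $$ (i, x * 2 ^ t + (if bit x (N - 1 - q) then g XOR 2 ^ (t - 1 - k) else g))"
proof -
  define g' where "g' = (if bit x (N - 1 - q) then g XOR 2 ^ (t - 1 - k) else g)"
  have g': "g' < 2 ^ t" using assms by (auto simp: g'_def intro!: xor_nat_less_exp)
  have "(2::nat) ^ (t - 1 - k) < 2 ^ t" using assms(2) by auto
  then have "(x * 2 ^ t + g) XOR 2 ^ (t - 1 - k) = x * 2 ^ t + (g XOR 2 ^ (t - 1 - k))"
    using xor_concat[OF assms(5), of "2 ^ (t - 1 - k)" x 0] by (simp only: mult_zero_left add_0 xor.right_neutral)
  moreover have "N + t - 1 - (N + k) = t - 1 - k" by simp
  moreover define K L where "K = N + t - 1 - q" and "L = N + t - 1 - (N + k)"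
  ultimately have map: "cnot_map K L (x * 2 ^ t + g) = x * 2 ^ t + g'"
    unfolding cnot_map_def g'_def K_def bit_register[OF assms(1,5)]
    by (cases "bit x (N - 1 - q)") (simp_all only: if_True if_False)
  have "circuit_mat (N + t) (CNOTg q (N + k) # gs) $$ (i, x * 2 ^ t + g) =
     (\<Sum>l<2 ^ (N + t). if l = x * 2 ^ t + g' then circuit_mat (N + t) gs $$ (i, x * 2 ^ t + g') else 0)"
    unfolding circuit_mat_Cons_index[OF assms(3) concat_less_exp[OF assms(4,5)]] gate_mat_CNOT
      K_def[symmetric] L_def[symmetric]
    using concat_less_exp[OF assms(4,5)] by (intro sum.cong) (auto simp: map)
  then show ?thesis using concat_less_exp[OF assms(4) g'] by (simp add: g'_def)
qed

text \<open>Gadget qubit \<open>k\<close> is bit \<open>t - 1 - k\<close> of the gadget index, and the gadgets already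
  consumed, projected onto 0, are the most significant ones.\<close>

lemma gadgetize_vanish:
  assumes "circuit_ok N gs" "k + num_T gs \<le> t" "x < 2 ^ N" "y < 2 ^ N"
    "g < 2 ^ t" "2 ^ (t - k) \<le> g"
  shows "circuit_mat (N + t) (gadgetize (N + k) gs) $$ (y * 2 ^ t, x * 2 ^ t + g) = 0"
  using assms
proof (induction gs arbitrary: k x g)
  case Nil
  have "y * 2 ^ t + 0 < 2 ^ (N + t)" by (rule concat_less_exp) (use Nil in auto)
  moreover have "x * 2 ^ t + g < 2 ^ (N + t)" by (rule concat_less_exp) (use Nil in auto)
  moreover have "y * 2 ^ t + 0 \<noteq> x * 2 ^ t + g"
    unfolding concat_eq_iff[OF zero_less_power[OF zero_less_numeral] Nil(5)] 
    using less_le_trans[OF _ Nil.prems(6), of 0] by auto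
  ultimately show ?case by simp
next
  case (Cons G gs)
  have y: "y * 2 ^ t < 2 ^ (N + t)" using concat_less_exp[of y N 0 t] Cons.prems by simp
  show ?case
  proof (cases "is_T G")
    case False
    then have "gadgetize (N + k) (G # gs) = G # gadgetize (N + k) gs" "num_T (G # gs) = num_T gs"
      by (cases G; simp add: num_T_def)+
    then show ?thesis using Cons y
      by (simp add: circuit_mat_Cons_index_embed circuit_ok_def)
  next
    case True
    then obtain q where G: "G = Tg q" by (cases G) auto
    have q: "q < N" "k < t" "circuit_ok N gs" "Suc k + num_T gs \<le> t"
      using Cons.prems by (auto simp: G circuit_ok_def num_T_def)
    define g' where "g' = (if bit x (N - 1 - q) then g XOR 2 ^ (t - 1 - k) else g)"
    have g': "g' < 2 ^ t" using Cons.prems q by (auto simp: g'_def intro!: xor_nat_less_exp)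
    \<comment> \<open>Some consumed gadget is 1. The current CNOT flips only bit
      \<open>t - 1 - k\<close>, so this bit persists up to the identity matrix of the empty circuit,
      where it contradicts the output 0.\<close>
    obtain l where "l \<ge> t - k" "bit g l"
      using Cons.prems(6) nat_less_exp_iff_bit[of g "t - k"] by auto
    then have "bit g' l" using q by (auto simp: g'_def bit_simps)
    with \<open>l \<ge> t - k\<close> have "\<not> g' < 2 ^ (t - Suc k)"
      unfolding nat_less_exp_iff_bit by (auto intro!: exI[of _ l])
    then show ?thesis
      using Cons.IH[of "Suc k" x g'] q g' Cons.prems y
      by (simp add: G circuit_mat_Cons_gadget g'_def)
  qed
qed

text \<open>The gadget identity \<open>U = 2^(t/2) <0^t| Ut |T^t>\<close>, in which the factor \<open>2^(t/2)\<close> cancels the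
  normalisation of \<open>|T^t>\<close>. Each \<open>T\<close> gate forces its gadget bit to agree with its control.\<close>

lemma gadgetize_sum:
  assumes "circuit_ok N gs" "k + num_T gs = t" "x < 2 ^ N" "y < 2 ^ N"
  shows "circuit_mat N gs $$ (y, x) = (\<Sum>g<2 ^ (t - k). tphase t g *
    circuit_mat (N + t) (gadgetize (N + k) gs) $$ (y * 2 ^ t, x * 2 ^ t + g))"
  using assms
proof (induction gs arbitrary: k x)
  case Nil
  then have "y * 2 ^ t + 0 < 2 ^ (N + t)" "x * 2 ^ t + 0 < 2 ^ (N + t)"
    using concat_less_exp[of _ N 0 t] by auto
  then show ?case using Nil by (simp add: num_T_def)
next
  case (Cons G gs)
  have y: "y * 2 ^ t < 2 ^ (N + t)" using concat_less_exp[of y N 0 t] Cons.prems by simp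
  have lt: "g < 2 ^ t" if "g < 2 ^ (t - k)" for g :: nat
    using that by (rule less_le_trans) simp
  let ?V = "\<lambda>k x g. circuit_mat (N + t) (gadgetize (N + k) gs) $$ (y * 2 ^ t, x * 2 ^ t + g)"
  show ?case
  proof (cases "is_T G")
    case False
    then have G: "gadgetize (N + k) (G # gs) = G # gadgetize (N + k) gs" "num_T (G # gs) = num_T gs"
      by (cases G; simp add: num_T_def)+
    have ok: "circuit_ok N gs" "gate_ok N G" using Cons.prems by (auto simp: circuit_ok_def)
    have "circuit_mat N (G # gs) $$ (y, x) = (\<Sum>z<2 ^ N. (\<Sum>g<2 ^ (t - k). tphase t g * ?V k z g) * gate_mat N G $$ (z, x))"
      unfolding circuit_mat_Cons_index[OF Cons.prems(4,3)]
      by (rule sum.cong) (use Cons ok G in auto)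
    also have "\<dots> = (\<Sum>g<2 ^ (t - k). tphase t g * (\<Sum>z<2 ^ N. ?V k z g * gate_mat N G $$ (z, x)))"
      unfolding sum_distrib_right sum_distrib_left
      by (subst sum.swap) (simp add: mult.assoc)
    also have "\<dots> = (\<Sum>g<2 ^ (t - k). tphase t g *
      circuit_mat (N + t) (gadgetize (N + k) (G # gs)) $$ (y * 2 ^ t, x * 2 ^ t + g))"
      unfolding G using Cons.prems ok y
      by (intro sum.cong) (auto simp: circuit_mat_Cons_index_embed lt)
    finally show ?thesis .
  next
    case True
    then obtain q where G: "G = Tg q" by (cases G) auto
    have q: "q < N" "k < t" "circuit_ok N gs" "Suc k + num_T gs = t"
      using Cons.prems by (auto simp: G circuit_ok_def num_T_def)
    define p where "p = t - 1 - k"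
    have p: "t - k = Suc p" "t - Suc k = p" "p < t" using q(2) by (auto simp: p_def)
    define B where "B = bit x (N - 1 - q)"
    define om where "om = (if B then cis (pi / 4) else 1 :: complex)"
    have "circuit_mat N (G # gs) $$ (y, x) = (\<Sum>z<2 ^ N. if z = x then circuit_mat N gs $$ (y, x) * om else 0)"
      unfolding circuit_mat_Cons_index[OF Cons.prems(4,3)] G gate_mat.simps bitq_eq_bit
      by (rule sum.cong) (use Cons.prems in \<open>auto simp: om_def B_def\<close>)
    also have "\<dots> = circuit_mat N gs $$ (y, x) * om"
      using Cons.prems by simp
    also have "circuit_mat N gs $$ (y, x) = (\<Sum>g<2 ^ p. tphase t g * ?V (Suc k) x g)"
      using Cons.IH[OF q(3,4)] Cons.prems p by simp
    \<comment> \<open>For \<open>g < 2 ^ p\<close> bit \<open>p\<close> is clear, so the phase of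
      the T gate is absorbed by setting that bit inside \<open>tphase\<close>.\<close>
    also have "\<dots> * om = (\<Sum>g<2 ^ p. tphase t (if B then g XOR 2 ^ p else g) * ?V (Suc k) x g)"
      unfolding sum_distrib_right
    proof (rule sum.cong)
      fix g :: nat assume "g \<in> {..<2 ^ p}"
      then have "\<not> bit g p" by (auto simp: nat_less_exp_iff_bit)
      then show "tphase t g * ?V (Suc k) x g * om = tphase t (if B then g XOR 2 ^ p else g) * ?V (Suc k) x g"
        using tphase_xor[OF p(3)] by (simp add: om_def)
    qed simp
    \<comment> \<open>The added indices have bit \<open>p\<close> set. This is the gadget of the
      current T gate, which no remaining gate touches, so its projection onto 0 makes these terms
      vanish.\<close>
    also have "\<dots> = (\<Sum>g<2 ^ Suc p. tphase t (if B then g XOR 2 ^ p else g) * ?V (Suc k) x g)"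
    proof (rule sum.mono_neutral_left)
      show "\<forall>g\<in>{..<2 ^ Suc p} - {..<2 ^ p}. tphase t (if B then g XOR 2 ^ p else g) * ?V (Suc k) x g = 0"
      proof
        fix g :: nat assume "g \<in> {..<2 ^ Suc p} - {..<2 ^ p}"
        then have "?V (Suc k) x g = 0"
          using q Cons.prems p lt[of g] by (intro gadgetize_vanish) auto
        then show "tphase t (if B then g XOR 2 ^ p else g) * ?V (Suc k) x g = 0" by simp
      qed
    qed auto
    \<comment> \<open>Translating \<open>g\<close> moves the flip from the phase to the column
      index, where it is the action of the gadget CNOT.\<close>
    also have "\<dots> = (\<Sum>g<2 ^ Suc p. tphase t g * ?V (Suc k) x (if B then g XOR 2 ^ p else g))"
      using sum_xor_reindex[of "2 ^ p" "Suc p" "\<lambda>g. tphase t (g XOR 2 ^ p) * ?V (Suc k) x g"]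
      by (cases B) simp_all
    also have "\<dots> = (\<Sum>g<2 ^ (t - k). tphase t g *
      circuit_mat (N + t) (gadgetize (N + k) (G # gs)) $$ (y * 2 ^ t, x * 2 ^ t + g))"
      unfolding p(1)[symmetric] using Cons.prems q y
      by (intro sum.cong) (simp_all add: G circuit_mat_Cons_gadget lt B_def p_def)
    finally show ?thesis .
  qed
qed

subsection \<open>Coordinates of the projected states and of the POVM elements\<close>

lemma kron_dim [simp]:
  "dim_row (kron A B) = dim_row A * dim_row B" "dim_col (kron A B) = dim_col A * dim_col B"
  by (simp_all add: kron_def)

lemma kron_carrier:
  "A \<in> carrier_mat n m \<Longrightarrow> B \<in> carrier_mat k l \<Longrightarrow> kron A B \<in> carrier_mat (n * k) (m * l)"
  by (metis carrier_mat_triv carrier_matD kron_dim)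

lemma concat_less_mult: "i < a \<Longrightarrow> k < b \<Longrightarrow> i * b + k < a * (b :: nat)"
  by (metis add.commute add_less_cancel_left mult.commute mult_Suc_right Suc_leI mult_le_mono2 less_le_trans)

lemma kron_index:
  assumes "A \<in> carrier_mat ra ca" "B \<in> carrier_mat rb cb" "i < ra" "j < ca" "k < rb" "l < cb"
  shows "kron A B $$ (i * rb + k, j * cb + l) = A $$ (i, j) * B $$ (k, l)"
proof -
  have "i * rb + k < ra * rb" "j * cb + l < ca * cb" using assms by (simp_all add: concat_less_mult)
  then show ?thesis using assms by (simp add: kron_def)
qed

lemma ket_col_dim [simp]: "dim_row (ket_col v) = dim_vec v" "dim_col (ket_col v) = 1"
  by (simp_all add: ket_col_def)

lemma ket_col_carrier: "dim_vec v = k \<Longrightarrow> ket_col v \<in> carrier_mat k 1"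
  by (simp add: ket_col_def)

lemma ket_col_index [simp]: "i < dim_vec v \<Longrightarrow> ket_col v $$ (i, 0) = v $ i"
  by (simp add: ket_col_def)

lemma mult_mat_unit_vec_index:
  assumes "A \<in> carrier_mat n k" "i < n" "b < k"
  shows "(A *\<^sub>v unit_vec k b) $ i = (A $$ (i, b) :: complex)"
  using assms by (simp add: scalar_prod_right_unit)

lemma stab_basis_vec_dim [simp]: "dim_vec (stab_basis_vec N C b) = 2 ^ N"
  using carrier_matD(1)[OF circuit_mat_carrier[of N C]] by (simp add: stab_basis_vec_def)

lemma stab_basis_vec_index:
  "i < 2 ^ N \<Longrightarrow> b < 2 ^ N \<Longrightarrow> stab_basis_vec N C b $ i = circuit_mat N C $$ (i, b)"
  unfolding stab_basis_vec_def by (rule mult_mat_unit_vec_index[OF circuit_mat_carrier])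

text \<open>The columns of \<open>heis N t gs C\<close> at \<open>b 2^t\<close> are the vectors \<open>Ut\<^sup>* (|\<Phi>\<^sub>b> \<otimes> |0^t>)\<close>.\<close>

definition heis :: "nat \<Rightarrow> nat \<Rightarrow> gate list \<Rightarrow> gate list \<Rightarrow> complex mat" where
  "heis N t gs C = mat_adjoint (circuit_mat (N + t) (gadgetize N gs)) * circuit_mat (N + t) C"

lemma clifford_circuit_mono: "clifford_circuit N C \<Longrightarrow> clifford_circuit (N + t) C"
proof -
  have "gate_ok N g \<Longrightarrow> gate_ok (N + t) g" for g by (cases g) auto
  then show "clifford_circuit N C \<Longrightarrow> clifford_circuit (N + t) C"
    by (auto simp: clifford_circuit_def circuit_ok_def list_all_iff)
qed

text \<open>With the basis circuit absorbed into a single Clifford, different outcomes are different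
  columns of one matrix, and their stabilizers differ only in sign.\<close>

lemma clifford_heis:
  assumes "circuit_ok N gs" "num_T gs \<le> t" "clifford_circuit N C"
  shows "clifford (N + t) (heis N t gs C)"
proof -
  have "clifford_circuit (N + t) (gadgetize N gs)"
    using clifford_gadgetize[OF assms(1), of 0 t] assms(2) by simp
  then show ?thesis unfolding heis_def
    by (rule clifford_mult[OF clifford_adjoint[OF clifford_circuit_mat]
          clifford_circuit_mat[OF clifford_circuit_mono[OF assms(3)]]])
qed

lemma heis_index:
  assumes "clifford_circuit N C" "j < 2 ^ (N + t)" "b < 2 ^ N"
  shows "heis N t gs C $$ (j, b * 2 ^ t) =
    (\<Sum>y<2 ^ N. cnj (circuit_mat (N + t) (gadgetize N gs) $$ (y * 2 ^ t, j)) * circuit_mat N C $$ (y, b))"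
proof -
  have b: "b * 2 ^ t + 0 < 2 ^ (N + t)" using assms by (intro concat_less_exp) auto
  have "heis N t gs C $$ (j, b * 2 ^ t) = (\<Sum>l<2 ^ (N + t).
    mat_adjoint (circuit_mat (N + t) (gadgetize N gs)) $$ (j, l) * circuit_mat (N + t) C $$ (l, b * 2 ^ t))"
    unfolding heis_def using assms b
    by (intro mult_mat_index_sum[OF mat_adjoint_carrier]) simp_all
  also have "\<dots> = (\<Sum>l<2 ^ (N + t).
    cnj (circuit_mat (N + t) (gadgetize N gs) $$ (l, j)) * circuit_mat (N + t) C $$ (l, b * 2 ^ t))"
    using assms carrier_matD[OF circuit_mat_carrier[of "N + t" "gadgetize N gs"]]
    by (intro sum.cong) (simp_all add: mat_adjoint_index)
  \<comment> \<open>\<open>C\<close> acts trivially on the gadgets, so its column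
    \<open>b * 2 ^ t\<close> is supported on \<open>h = 0\<close>, the gadget output 0.\<close>
  also have "\<dots> = (\<Sum>y<2 ^ N. \<Sum>h<(2::nat) ^ t. if h = 0 then
    cnj (circuit_mat (N + t) (gadgetize N gs) $$ (y * 2 ^ t, j)) * circuit_mat N C $$ (y, b) else 0)"
    unfolding sum_concat
    using assms circuit_mat_embed[of N C _ b _ t 0]
    by (intro sum.cong) (auto simp: clifford_circuit_def)
  finally show ?thesis by simp
qed

lemma proj_state_carrier:
  "proj_state n m t \<psi> gs C b \<in> carrier_mat (2 ^ (n + t)) 1"
  by (intro carrier_matI) (simp_all only: proj_state_def Let_def index_mult_mat kron_dim
      mat_adjoint_dim ket_col_dim index_one_mat power_add mult_1_right)

text \<open>Unfolds the Kronecker products into the three-register index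
  \<open>(d * 2 ^ m + e) * 2 ^ t + g\<close>, with data \<open>d\<close>, ancillas \<open>e\<close>
  and gadgets \<open>g\<close>.\<close>

lemma proj_state_index:
  assumes \<psi>: "dim_vec \<psi> = 2 ^ m" and C: "clifford_circuit (n + m) C"
    and b: "b < 2 ^ (n + m)" and d: "d < 2 ^ n" and g: "g < 2 ^ t"
  shows "proj_state n m t \<psi> gs C b $$ (d * 2 ^ t + g, 0) =
    (\<Sum>e<2 ^ m. cnj (\<psi> $ e) * heis (n + m) t gs C $$ ((d * 2 ^ m + e) * 2 ^ t + g, b * 2 ^ t))"
proof -
  define K where "K = kron (1\<^sub>m (2 ^ n)) (mat_adjoint (ket_col \<psi>))"
  define W where "W = kron K (1\<^sub>m (2 ^ t))"
  define Ut where "Ut = circuit_mat (n + m + t) (gadgetize (n + m) gs)"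
  define F where "F = kron (ket_col (stab_basis_vec (n + m) C b)) (ket_col (unit_vec (2 ^ t) 0))"
  have K: "K \<in> carrier_mat (2 ^ n * 1) (2 ^ n * 2 ^ m)"
    unfolding K_def by (intro kron_carrier mat_adjoint_carrier ket_col_carrier \<psi>) auto
  have W: "W \<in> carrier_mat (2 ^ (n + t)) (2 ^ (n + m + t))"
    using kron_carrier[OF K, of "1\<^sub>m (2 ^ t)" "2 ^ t" "2 ^ t"] by (simp add: W_def power_add)
  have Ut: "mat_adjoint Ut \<in> carrier_mat (2 ^ (n + m + t)) (2 ^ (n + m + t))"
    unfolding Ut_def by (rule mat_adjoint_carrier) simp
  have F: "F \<in> carrier_mat (2 ^ (n + m + t)) 1"
    using kron_carrier[OF ket_col_carrier ket_col_carrier, of "stab_basis_vec (n + m) C b" "2 ^ (n + m)"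
        "unit_vec (2 ^ t) 0" "2 ^ t"] by (simp add: F_def power_add)
  have Wi: "W $$ (d * 2 ^ t + g, (d' * 2 ^ m + e) * 2 ^ t + g') =
      (if d = d' \<and> g = g' then cnj (\<psi> $ e) else 0)"
    if "d' < 2 ^ n" "e < 2 ^ m" "g' < 2 ^ t" for d' e g'
  proof -
    have "d' * 2 ^ m + e < 2 ^ n * 2 ^ m" using that by (simp add: concat_less_mult)
    then have "W $$ (d * 2 ^ t + g, (d' * 2 ^ m + e) * 2 ^ t + g') = K $$ (d, d' * 2 ^ m + e) * 1\<^sub>m (2 ^ t) $$ (g, g')"
      unfolding W_def using d g that by (intro kron_index[OF K]) auto
    moreover have "K $$ (d * 1 + 0, d' * 2 ^ m + e) = 1\<^sub>m (2 ^ n) $$ (d, d') * mat_adjoint (ket_col \<psi>) $$ (0, e)"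
      unfolding K_def using d that \<psi>
      by (intro kron_index[OF one_carrier_mat mat_adjoint_carrier[OF ket_col_carrier]]) auto
    ultimately show ?thesis
      using d g that \<psi> by (simp add: mat_adjoint_index ket_col_def)
  qed
  have Fi: "F $$ (y * 2 ^ t + h, 0) = (if h = 0 then circuit_mat (n + m) C $$ (y, b) else 0)"
    if "y < 2 ^ (n + m)" "h < 2 ^ t" for y h
    using kron_index[OF ket_col_carrier ket_col_carrier, of "stab_basis_vec (n + m) C b" "2 ^ (n + m)"
        "unit_vec (2 ^ t) 0" "2 ^ t" y 0 h 0] that b
    by (simp add: F_def stab_basis_vec_index)
  have UF: "(mat_adjoint Ut * F) $$ (j, 0) = heis (n + m) t gs C $$ (j, b * 2 ^ t)" if j: "j < 2 ^ (n + m + t)" for j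
  proof -
    have "(mat_adjoint Ut * F) $$ (j, 0) = (\<Sum>l<2 ^ (n + m + t). mat_adjoint Ut $$ (j, l) * F $$ (l, 0))"
      by (rule mult_mat_index_sum[OF Ut F j]) simp
    also have "\<dots> = (\<Sum>l<2 ^ (n + m + t). cnj (Ut $$ (l, j)) * F $$ (l, 0))"
      using j carrier_matD[OF circuit_mat_carrier[of "n + m + t" "gadgetize (n + m) gs"]]
      by (intro sum.cong) (simp_all add: mat_adjoint_index Ut_def)
    also have "\<dots> = (\<Sum>y<2 ^ (n + m). \<Sum>h<(2::nat) ^ t. if h = 0 then
        cnj (Ut $$ (y * 2 ^ t, j)) * circuit_mat (n + m) C $$ (y, b) else 0)"
      unfolding sum_concat[of _ "n + m" t] by (intro sum.cong) (auto simp: Fi)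
    finally show ?thesis unfolding heis_index[OF C j b] by (simp add: Ut_def)
  qed
  have "proj_state n m t \<psi> gs C b = W * (mat_adjoint Ut * F)"
    unfolding proj_state_def Let_def W_def[symmetric, unfolded K_def] Ut_def[symmetric] F_def[symmetric]
    by (rule assoc_mult_mat[OF W Ut F])
  then have "proj_state n m t \<psi> gs C b $$ (d * 2 ^ t + g, 0) =
      (\<Sum>j<2 ^ (n + m + t). W $$ (d * 2 ^ t + g, j) * (mat_adjoint Ut * F) $$ (j, 0))"
    using concat_less_exp[OF d g] mult_mat_index_sum[OF W mult_carrier_mat[OF Ut F]] by simp
  also have "\<dots> = (\<Sum>j<2 ^ (n + m + t). W $$ (d * 2 ^ t + g, j) * heis (n + m) t gs C $$ (j, b * 2 ^ t))"
    by (rule sum.cong) (auto simp: UF)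
  also have "\<dots> = (\<Sum>d'<(2::nat) ^ n. \<Sum>e<2 ^ m. \<Sum>g'<(2::nat) ^ t. if g' = g then if d' = d then
      cnj (\<psi> $ e) * heis (n + m) t gs C $$ ((d * 2 ^ m + e) * 2 ^ t + g, b * 2 ^ t) else 0 else 0)"
    unfolding sum_concat[of _ "n + m" t] sum_concat[of _ n m]
    by (intro sum.cong) (auto simp: Wi)
  also have "\<dots> = (\<Sum>d'<(2::nat) ^ n. if d' = d then \<Sum>e<2 ^ m. 
      cnj (\<psi> $ e) * heis (n + m) t gs C $$ ((d * 2 ^ m + e) * 2 ^ t + g, b * 2 ^ t) else 0)"
    using g by (intro sum.cong) auto
  finally show ?thesis using d by simp
qed

text \<open>The contraction of v_b with <T| on all gadgets, unnormalised so that it equals (I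
  \<otimes> <\<psi>|) applied to the adjoint of U on the basis vector, with no leftover power of
  2.\<close>

definition contracted_state :: "nat \<Rightarrow> nat \<Rightarrow> nat \<Rightarrow> complex vec \<Rightarrow> gate list \<Rightarrow> gate list \<Rightarrow> nat \<Rightarrow> nat \<Rightarrow> complex" where
  "contracted_state n m t \<psi> gs C b d =
     (\<Sum>g<2 ^ t. cnj (tphase t g) * proj_state n m t \<psi> gs C b $$ (d * 2 ^ t + g, 0))"

lemma povm_elem_carrier:
  "povm_elem n m \<psi> gs C b \<in> carrier_mat (2 ^ n) (2 ^ n)"
  by (intro carrier_matI) (simp_all only: povm_elem_def Let_def index_mult_mat kron_dim
      mat_adjoint_dim ket_col_dim index_one_mat mult_1_right)

text \<open>Each element has rank one, \<open>x * mat_adjoint x\<close>; the conjugated gadget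
  identity expresses \<open>x\<close> through the projected state.\<close>

lemma povm_elem_index:
  assumes \<psi>: "dim_vec \<psi> = 2 ^ m" and C: "clifford_circuit (n + m) C"
    and gs: "circuit_ok (n + m) gs" "num_T gs = t"
    and b: "b < 2 ^ (n + m)" and d: "d < 2 ^ n" "d' < 2 ^ n"
  shows "povm_elem n m \<psi> gs C b $$ (d, d') =
    contracted_state n m t \<psi> gs C b d * cnj (contracted_state n m t \<psi> gs C b d')"
proof -
  let ?N = "n + m"
  define V where "V = kron (1\<^sub>m (2 ^ n)) (ket_col \<psi>)"
  define U where "U = circuit_mat ?N gs"
  define F where "F = ket_col (stab_basis_vec ?N C b)"
  define x where "x = mat_adjoint V * (mat_adjoint U * F)"
  have V: "V \<in> carrier_mat (2 ^ ?N) (2 ^ n)"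
    using kron_carrier[OF one_carrier_mat ket_col_carrier[OF \<psi>], of "2 ^ n"] by (simp add: V_def power_add)
  have U: "U \<in> carrier_mat (2 ^ ?N) (2 ^ ?N)" by (simp add: U_def)
  have F: "F \<in> carrier_mat (2 ^ ?N) 1" unfolding F_def by (rule ket_col_carrier) simp
  note ad = mat_adjoint_carrier[OF V] mat_adjoint_carrier[OF U] mat_adjoint_carrier[OF F]
  have x: "x \<in> carrier_mat (2 ^ n) 1" unfolding x_def
    by (rule mult_carrier_mat[OF ad(1) mult_carrier_mat[OF ad(2) F]])
  have xadj: "mat_adjoint x = mat_adjoint F * U * V"
    unfolding x_def mat_adjoint_mult[OF ad(1) mult_carrier_mat[OF ad(2) F]] mat_adjoint_mult[OF ad(2) F]
    by simp
  define A where "A = mat_adjoint V * mat_adjoint U"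
  have A: "A \<in> carrier_mat (2 ^ n) (2 ^ ?N)" unfolding A_def by (rule mult_carrier_mat[OF ad(1,2)])
  have "povm_elem n m \<psi> gs C b = A * (F * mat_adjoint F) * U * V"
    unfolding povm_elem_def Let_def V_def[symmetric] U_def[symmetric] F_def[symmetric] A_def ..
  also have "A * (F * mat_adjoint F) = A * F * mat_adjoint F"
    by (rule assoc_mult_mat[OF A F ad(3), symmetric])
  also have "A * F = x" unfolding A_def x_def by (rule assoc_mult_mat[OF ad(1,2) F])
  also have "x * mat_adjoint F * U = x * (mat_adjoint F * U)"
    by (rule assoc_mult_mat[OF x ad(3) U])
  also have "x * (mat_adjoint F * U) * V = x * (mat_adjoint F * U * V)"
    by (rule assoc_mult_mat[OF x mult_carrier_mat[OF ad(3) U] V])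
  also have "\<dots> = x * mat_adjoint x" unfolding xadj ..
  finally have povm: "povm_elem n m \<psi> gs C b $$ (d, d') = x $$ (d, 0) * cnj (x $$ (d', 0))"
    using mult_mat_index_sum[OF x mat_adjoint_carrier[OF x] d] d x by (simp add: mat_adjoint_index)
  have UF: "(mat_adjoint U * F) $$ (j, 0) = (\<Sum>g<2 ^ t. cnj (tphase t g) * heis ?N t gs C $$ (j * 2 ^ t + g, b * 2 ^ t))"
    if j: "j < 2 ^ ?N" for j
  proof -
    have "(mat_adjoint U * F) $$ (j, 0) = (\<Sum>y<2 ^ ?N. mat_adjoint U $$ (j, y) * F $$ (y, 0))"
      by (rule mult_mat_index_sum[OF ad(2) F j]) simp
    also have "\<dots> = (\<Sum>y<2 ^ ?N. cnj (U $$ (y, j)) * circuit_mat ?N C $$ (y, b))"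
      using U j b by (intro sum.cong) (simp_all add: mat_adjoint_index F_def stab_basis_vec_index)
    also have "\<dots> = (\<Sum>y<2 ^ ?N. \<Sum>g<2 ^ t. cnj (tphase t g) *
        (cnj (circuit_mat (?N + t) (gadgetize ?N gs) $$ (y * 2 ^ t, j * 2 ^ t + g)) * circuit_mat ?N C $$ (y, b)))"
      using gadgetize_sum[OF gs(1), of 0 t j] gs(2) j
      by (intro sum.cong) (simp_all add: U_def sum_distrib_right mult.assoc)
    also have "\<dots> = (\<Sum>g<2 ^ t. cnj (tphase t g) * heis ?N t gs C $$ (j * 2 ^ t + g, b * 2 ^ t))"
      using j b by (subst sum.swap) (simp add: heis_index[OF C] concat_less_exp sum_distrib_left)
    finally show ?thesis .
  qed
  have Vi: "V $$ (d' * 2 ^ m + e, d) = (if d = d' then \<psi> $ e else 0)"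
    if "d' < 2 ^ n" "e < 2 ^ m" "d < 2 ^ n" for d' e d
    using kron_index[OF one_carrier_mat ket_col_carrier[OF \<psi>], of d' "2 ^ n" d e 0] that \<psi>
    by (simp add: V_def)
  have "x $$ (d, 0) = contracted_state n m t \<psi> gs C b d" if d: "d < 2 ^ n" for d
  proof -
    have "x $$ (d, 0) = (\<Sum>j<2 ^ ?N. mat_adjoint V $$ (d, j) * (mat_adjoint U * F) $$ (j, 0))"
      unfolding x_def by (rule mult_mat_index_sum[OF ad(1) mult_carrier_mat[OF ad(2) F] d]) simp
    also have "\<dots> = (\<Sum>j<2 ^ ?N. cnj (V $$ (j, d)) * (mat_adjoint U * F) $$ (j, 0))"
      using V d by (intro sum.cong) (simp_all add: mat_adjoint_index)
    also have "\<dots> = (\<Sum>d'<(2::nat) ^ n. if d' = d then \<Sum>e<2 ^ m. cnj (\<psi> $ e) * (mat_adjoint U * F) $$ (d * 2 ^ m + e, 0) else 0)"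
      unfolding sum_concat using d by (intro sum.cong) (auto simp: Vi)
    also have "\<dots> = (\<Sum>e<2 ^ m. \<Sum>g<2 ^ t. cnj (tphase t g) *
        (cnj (\<psi> $ e) * heis ?N t gs C $$ ((d * 2 ^ m + e) * 2 ^ t + g, b * 2 ^ t)))"
      using d by (auto simp: UF concat_less_exp sum_distrib_left mult_ac intro!: sum.cong)
    also have "\<dots> = contracted_state n m t \<psi> gs C b d"
      unfolding contracted_state_def
      by (subst sum.swap) (simp add: proj_state_index[OF \<psi> C b d] sum_distrib_left)
    finally show ?thesis .
  qed
  then show ?thesis using povm d by simp
qed

subsection \<open>Stabilizers of projected states\<close>

lemma mult_cnj_eq_norm: "z * cnj z = complex_of_real ((cmod z)\<^sup>2)"
  by (simp add: complex_mult_cnj cmod_power2)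

text \<open>Column \<open>B\<close> of \<open>W\<close> is a joint eigenvector of the conjugates of
  all \<open>Z^c\<close> by \<open>W\<close>, which are Paulis up to phase. Fourier inversion over
  \<open>c\<close> recovers the projector onto the column. The labels \<open>fa c\<close> and
  \<open>fc c\<close> do not involve \<open>B\<close>, which enters only through the sign
  \<open>wchar N c B\<close>.\<close>

lemma clifford_stabilizers:
  assumes W: "clifford N W"
  obtains fa fc ph where
    "\<And>c. c < 2 ^ N \<Longrightarrow> fa c < 2 ^ N" "\<And>c. c < 2 ^ N \<Longrightarrow> fc c < 2 ^ N"
    "\<And>c. c < 2 ^ N \<Longrightarrow> cmod (ph c) = 1"
    "\<And>c i B. c < 2 ^ N \<Longrightarrow> i < 2 ^ N \<Longrightarrow> B < 2 ^ N \<Longrightarrow>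
       wchar N c B * W $$ (i, B) = ph c * (wchar N (fc c) (i XOR fa c) * W $$ (i XOR fa c, B))"
    "\<And>i j B. i < 2 ^ N \<Longrightarrow> j < 2 ^ N \<Longrightarrow> B < 2 ^ N \<Longrightarrow>
       2 ^ N * (W $$ (i, B) * cnj (W $$ (j, B))) =
       (\<Sum>c<2 ^ N. wchar N c B * ph c * pauli N (fa c) (fc c) $$ (i, j))"
proof -
  have Wc: "W \<in> carrier_mat (2 ^ N) (2 ^ N)" "mat_adjoint W \<in> carrier_mat (2 ^ N) (2 ^ N)"
    using clifford_carrier[OF W] by (auto intro: mat_adjoint_carrier)
  have "\<forall>c<2 ^ N. \<exists>a' c' ph. a' < 2 ^ N \<and> c' < 2 ^ N \<and> cmod ph = 1 \<and>
      W * pauli N 0 c = ph \<cdot>\<^sub>m (pauli N a' c' * W)"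
    using W unfolding clifford_def normalizes_pauli_def by (metis zero_less_numeral zero_less_power)
  then obtain fa fc ph where f: "\<And>c. c < 2 ^ N \<Longrightarrow> fa c < 2 ^ N \<and> fc c < 2 ^ N \<and> cmod (ph c) = 1 \<and>
      W * pauli N 0 c = ph c \<cdot>\<^sub>m (pauli N (fa c) (fc c) * W)"
    by metis
  have 1: "wchar N c B * W $$ (i, B) = ph c * (wchar N (fc c) (i XOR fa c) * W $$ (i XOR fa c, B))"
    if "c < 2 ^ N" "i < 2 ^ N" "B < 2 ^ N" for c i B
  proof -
    have "(W * pauli N 0 c) $$ (i, B) = W $$ (i, B XOR 0) * wchar N c B"
      by (rule mult_pauli_index[OF Wc(1)]) (use that in auto)
    moreover have "(W * pauli N 0 c) $$ (i, B) = ph c * (pauli N (fa c) (fc c) * W) $$ (i, B)"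
      using f[OF that(1)] that carrier_matD[OF Wc(1)] by simp
    moreover have "(pauli N (fa c) (fc c) * W) $$ (i, B) = wchar N (fc c) (i XOR fa c) * W $$ (i XOR fa c, B)"
      by (rule pauli_mult_index[OF Wc(1)]) (use that f in auto)
    ultimately show ?thesis by (simp add: mult.commute)
  qed
  have 2: "ph c * pauli N (fa c) (fc c) $$ (i, j) = (\<Sum>l<2 ^ N. W $$ (i, l) * wchar N c l * cnj (W $$ (j, l)))"
    if "c < 2 ^ N" "i < 2 ^ N" "j < 2 ^ N" for c i j
  proof -
    have WW: "W * mat_adjoint W = 1\<^sub>m (2 ^ N)" using W by (simp add: clifford_def)
    have "W * pauli N 0 c * mat_adjoint W = ph c \<cdot>\<^sub>m (pauli N (fa c) (fc c) * W * mat_adjoint W)"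
      using f[OF that(1)] mult_smult_assoc_mat[OF mult_carrier_mat[OF pauli_carrier Wc(1)] Wc(2)] by simp
    also have "pauli N (fa c) (fc c) * W * mat_adjoint W = pauli N (fa c) (fc c)"
      using assoc_mult_mat[OF pauli_carrier Wc] WW right_mult_one_mat[OF pauli_carrier] by simp
    finally have "ph c * pauli N (fa c) (fc c) $$ (i, j) = (W * pauli N 0 c * mat_adjoint W) $$ (i, j)"
      using that by simp
    also have "\<dots> = (\<Sum>l<2 ^ N. (W * pauli N 0 c) $$ (i, l) * mat_adjoint W $$ (l, j))"
      by (rule mult_mat_index_sum[OF mult_carrier_mat[OF Wc(1) pauli_carrier] Wc(2) that(2,3)])
    also have "\<dots> = (\<Sum>l<2 ^ N. W $$ (i, l) * wchar N c l * cnj (W $$ (j, l)))"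
    proof (rule sum.cong)
      fix l assume "l \<in> {..<(2::nat) ^ N}"
      then have l: "l < 2 ^ N" by simp
      have "(W * pauli N 0 c) $$ (i, l) = W $$ (i, l XOR 0) * wchar N c l"
        by (rule mult_pauli_index[OF Wc(1)]) (use that l in auto)
      then show "(W * pauli N 0 c) $$ (i, l) * mat_adjoint W $$ (l, j) = W $$ (i, l) * wchar N c l * cnj (W $$ (j, l))"
        using that l carrier_matD[OF Wc(1)] by (simp add: mat_adjoint_index)
    qed simp
    finally show ?thesis .
  qed
  have 3: "2 ^ N * (W $$ (i, B) * cnj (W $$ (j, B))) =
       (\<Sum>c<2 ^ N. wchar N c B * ph c * pauli N (fa c) (fc c) $$ (i, j))"
    if "i < 2 ^ N" "j < 2 ^ N" "B < 2 ^ N" for i j B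
  proof -
    have "(\<Sum>c<2 ^ N. wchar N c B * ph c * pauli N (fa c) (fc c) $$ (i, j)) =
      (\<Sum>c<2 ^ N. \<Sum>l<2 ^ N. W $$ (i, l) * cnj (W $$ (j, l)) * wchar N c (l XOR B))"
    proof (rule sum.cong)
      fix c assume "c \<in> {..<(2::nat) ^ N}"
      then have "wchar N c B * (ph c * pauli N (fa c) (fc c) $$ (i, j)) =
        (\<Sum>l<2 ^ N. wchar N c B * (W $$ (i, l) * wchar N c l * cnj (W $$ (j, l))))"
        using 2 that by (simp add: sum_distrib_left)
      then show "wchar N c B * ph c * pauli N (fa c) (fc c) $$ (i, j) =
        (\<Sum>l<2 ^ N. W $$ (i, l) * cnj (W $$ (j, l)) * wchar N c (l XOR B))"
        by (simp add: wchar_xor mult_ac)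
    qed simp
    also have "\<dots> = (\<Sum>l<2 ^ N. W $$ (i, l) * cnj (W $$ (j, l)) * (\<Sum>c<2 ^ N. wchar N c (l XOR B)))"
      by (subst sum.swap) (simp add: sum_distrib_left)
    also have "\<dots> = (\<Sum>l<2 ^ N. if l = B then 2 ^ N * (W $$ (i, B) * cnj (W $$ (j, B))) else 0)"
    proof (rule sum.cong)
      fix l assume "l \<in> {..<(2::nat) ^ N}"
      then have "l XOR B < 2 ^ N" using that by (simp add: xor_nat_less_exp)
      moreover have "l XOR B = 0 \<longleftrightarrow> l = B" using xor_nat_eq_iff[of 0 l B] by auto
      ultimately show "W $$ (i, l) * cnj (W $$ (j, l)) * (\<Sum>c<2 ^ N. wchar N c (l XOR B)) =
        (if l = B then 2 ^ N * (W $$ (i, B) * cnj (W $$ (j, B))) else 0)"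
        by (simp add: sum_wchar)
    qed simp
    finally show ?thesis using that by simp
  qed
  show thesis using that[of fa fc ph] f 1 3 by blast
qed

text \<open>Write \<psi> as a phase times U|0>. Pushing the Pauli through the adjoint of U turns <0|
  into a phase times <a'|. Thus <\<psi>|P is proportional to <\<psi>| if \<open>a' = 0\<close>, and
  otherwise comes from a different column of U, orthogonal to \<psi>.\<close>

lemma stabilizer_state_expectation:
  assumes "stabilizer_state m \<psi>" "a < 2 ^ m" "c < 2 ^ m"
  shows "(\<Sum>e<2 ^ m. cnj (\<psi> $ (e XOR a)) * wchar m c e * \<psi> $ e) = 0 \<or>
    (\<exists>ph. cmod ph = 1 \<and> (\<forall>e<2 ^ m. cnj (\<psi> $ (e XOR a)) * wchar m c e = ph * cnj (\<psi> $ e)))"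
proof -
  obtain C \<gamma> where C: "clifford_circuit m C" "\<psi> = \<gamma> \<cdot>\<^sub>v (circuit_mat m C *\<^sub>v unit_vec (2 ^ m) 0)"
    using assms(1) unfolding stabilizer_state_def by blast
  define U where "U = circuit_mat m C"
  have U: "clifford m U" unfolding U_def by (rule clifford_circuit_mat[OF C(1)])
  then have Uc: "U \<in> carrier_mat (2 ^ m) (2 ^ m)" "mat_adjoint U \<in> carrier_mat (2 ^ m) (2 ^ m)"
    by (auto intro: mat_adjoint_carrier clifford_carrier)
  have psi: "\<psi> $ e = \<gamma> * U $$ (e, 0)" if "e < 2 ^ m" for e
    using that carrier_matD[OF Uc(1)] mult_mat_unit_vec_index[OF Uc(1) that, of 0]
    by (simp add: C(2) U_def)
  obtain a' c' ph where P: "a' < 2 ^ m" "c' < 2 ^ m" "cmod ph = 1"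
    "mat_adjoint U * pauli m a c = ph \<cdot>\<^sub>m (pauli m a' c' * mat_adjoint U)"
    using U assms(2,3) unfolding clifford_def normalizes_pauli_def by blast
  have row: "cnj (U $$ (e XOR a, 0)) * wchar m c e = ph * (wchar m c' a' * cnj (U $$ (e, a')))"
    if e: "e < 2 ^ m" for e
  proof -
    have "(mat_adjoint U * pauli m a c) $$ (0, e) = mat_adjoint U $$ (0, e XOR a) * wchar m c e"
      by (rule mult_pauli_index[OF Uc(2)]) (use e assms in auto)
    moreover have "(pauli m a' c' * mat_adjoint U) $$ (0, e) = wchar m c' (0 XOR a') * mat_adjoint U $$ (0 XOR a', e)"
      by (rule pauli_mult_index[OF Uc(2)]) (use e P in auto)
    moreover have "(mat_adjoint U * pauli m a c) $$ (0, e) = ph * (pauli m a' c' * mat_adjoint U) $$ (0, e)"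
      using P e carrier_matD[OF Uc(1)] by simp
    ultimately show ?thesis
      using e P assms xor_nat_less_exp[OF e assms(2)] carrier_matD[OF Uc(1)] by (simp add: mat_adjoint_index)
  qed
  show ?thesis
  proof (cases "a' = 0")
    case True
    have "cnj (\<psi> $ (e XOR a)) * wchar m c e = ph * cnj (\<psi> $ e)" if e: "e < 2 ^ m" for e
      using row[OF e] True xor_nat_less_exp[OF e assms(2)] e by (simp add: psi mult_ac)
    then show ?thesis using P by blast
  next
    case False
    have "(\<Sum>e<2 ^ m. cnj (\<psi> $ (e XOR a)) * wchar m c e * \<psi> $ e) =
      (\<Sum>e<2 ^ m. cnj \<gamma> * \<gamma> * ph * wchar m c' a' * (cnj (U $$ (e, a')) * U $$ (e, 0)))"
    proof (rule sum.cong)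
      fix e assume "e \<in> {..<(2::nat) ^ m}"
      then have e: "e < 2 ^ m" by simp
      have "cnj (\<psi> $ (e XOR a)) * wchar m c e * \<psi> $ e =
        cnj \<gamma> * \<gamma> * (cnj (U $$ (e XOR a, 0)) * wchar m c e) * U $$ (e, 0)"
        using xor_nat_less_exp[OF e assms(2)] e by (simp add: psi mult_ac)
      then show "cnj (\<psi> $ (e XOR a)) * wchar m c e * \<psi> $ e =
          cnj \<gamma> * \<gamma> * ph * wchar m c' a' * (cnj (U $$ (e, a')) * U $$ (e, 0))"
        unfolding row[OF e] by (simp add: mult_ac)
    qed simp
    also have "\<dots> = cnj \<gamma> * \<gamma> * ph * wchar m c' a' * (\<Sum>e<2 ^ m. mat_adjoint U $$ (a', e) * U $$ (e, 0))"
      using P carrier_matD[OF Uc(1)] by (simp add: sum_distrib_left mat_adjoint_index)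
    also have "(\<Sum>e<2 ^ m. mat_adjoint U $$ (a', e) * U $$ (e, 0)) = (mat_adjoint U * U) $$ (a', 0)"
      using P by (intro mult_mat_index_sum[OF Uc(2,1), symmetric]) auto
    also have "\<dots> = 0" using U P False by (simp add: clifford_def)
    finally show ?thesis by simp
  qed
qed

definition partial_contract :: "nat \<Rightarrow> nat \<Rightarrow> (nat \<Rightarrow> complex) \<Rightarrow> (nat \<Rightarrow> complex) \<Rightarrow> nat \<Rightarrow> nat \<Rightarrow> complex" where
  "partial_contract m t \<phi> x d g = (\<Sum>e<2 ^ m. cnj (\<phi> e) * x ((d * 2 ^ m + e) * 2 ^ t + g))"

text \<open>Contracting P1 \<otimes> P2 \<otimes> P3 with \<phi> on the ancillas leaves
  <\<phi>|P2|\<phi>> times P1 \<otimes> P3. A zero expectation removes the term from the projector;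
  a nonzero one means that <\<phi>| absorbs P2 up to a phase, so P1 \<otimes> P3 still stabilizes
  the contracted column. Indices in \<open>J\<close> may carry equal labels.\<close>

lemma projected_column_paulis:
  fixes \<phi> :: "nat \<Rightarrow> complex" and v :: "nat \<Rightarrow> nat \<Rightarrow> nat \<Rightarrow> complex"
  assumes W: "clifford (n + m + t) W"
    and \<phi>: "\<And>a c. a < 2 ^ m \<Longrightarrow> c < 2 ^ m \<Longrightarrow>
      (\<Sum>e<2 ^ m. cnj (\<phi> (e XOR a)) * wchar m c e * \<phi> e) = 0 \<or>
      (\<exists>ph. cmod ph = 1 \<and> (\<forall>e<2 ^ m. cnj (\<phi> (e XOR a)) * wchar m c e = ph * cnj (\<phi> e)))"
    and v_def: "\<And>B d g. v B d g = partial_contract m t \<phi> (\<lambda>i. W $$ (i, B)) d g"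
  obtains J :: "nat set" and a1 c1 a3 c3 and coef :: "nat \<Rightarrow> nat \<Rightarrow> complex" where
    "finite J"
    "\<And>j. j \<in> J \<Longrightarrow> a1 j < 2 ^ n \<and> c1 j < 2 ^ n \<and> a3 j < 2 ^ t \<and> c3 j < 2 ^ t"
    "\<And>j B. j \<in> J \<Longrightarrow> B < 2 ^ (n + m + t) \<Longrightarrow> \<exists>ph. cmod ph = 1 \<and> (\<forall>d<2 ^ n. \<forall>g<2 ^ t.
       v B d g = ph * (wchar n (c1 j) (d XOR a1 j) * wchar t (c3 j) (g XOR a3 j) * v B (d XOR a1 j) (g XOR a3 j)))"
    "\<And>B d d' g g'. B < 2 ^ (n + m + t) \<Longrightarrow> d < 2 ^ n \<Longrightarrow> d' < 2 ^ n \<Longrightarrow> g < 2 ^ t \<Longrightarrow> g' < 2 ^ t \<Longrightarrow>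
       v B d g * cnj (v B d' g') =
       (\<Sum>j\<in>J. coef B j * pauli n (a1 j) (c1 j) $$ (d, d') * pauli t (a3 j) (c3 j) $$ (g, g'))"
proof -
  let ?N = "n + m + t"
  obtain fa fc ph where f: "\<And>c. c < 2 ^ ?N \<Longrightarrow> fa c < 2 ^ ?N" "\<And>c. c < 2 ^ ?N \<Longrightarrow> fc c < 2 ^ ?N"
    and ph: "\<And>c. c < 2 ^ ?N \<Longrightarrow> cmod (ph c) = 1"
    and stab: "\<And>c i B. c < 2 ^ ?N \<Longrightarrow> i < 2 ^ ?N \<Longrightarrow> B < 2 ^ ?N \<Longrightarrow>
       wchar ?N c B * W $$ (i, B) = ph c * (wchar ?N (fc c) (i XOR fa c) * W $$ (i XOR fa c, B))"
    and proj: "\<And>i j B. i < 2 ^ ?N \<Longrightarrow> j < 2 ^ ?N \<Longrightarrow> B < 2 ^ ?N \<Longrightarrow>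
       2 ^ ?N * (W $$ (i, B) * cnj (W $$ (j, B))) =
       (\<Sum>c<2 ^ ?N. wchar ?N c B * ph c * pauli ?N (fa c) (fc c) $$ (i, j))"
    by (rule clifford_stabilizers[OF W], rule that)
  define p1 p2 p3 where "p1 = (\<lambda>i::nat. i div 2 ^ t div 2 ^ m)" and "p2 = (\<lambda>i::nat. i div 2 ^ t mod 2 ^ m)"
    and "p3 = (\<lambda>i::nat. i mod 2 ^ t)"
  have p: "p1 i < 2 ^ n" "p2 i < 2 ^ m" "p3 i < 2 ^ t" if "i < 2 ^ ?N" for i
    using that by (simp_all add: p1_def p2_def p3_def div_less_exp)
  have pi: "(p1 i * 2 ^ m + p2 i) * 2 ^ t + p3 i = i" for i
    unfolding p1_def p2_def p3_def div_mult_mod_eq ..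
  \<comment> \<open>\<open>r c\<close> is the expectation in \<phi> of the ancilla factor of the
    \<open>c\<close>-th stabilizer.\<close>
  define r where "r = (\<lambda>c. \<Sum>e<2 ^ m. cnj (\<phi> (e XOR p2 (fa c))) * wchar m (p2 (fc c)) e * \<phi> e)"
  define J where "J = {c \<in> {..<2 ^ ?N}. r c \<noteq> 0}"
  have xorN: "((d * 2 ^ m + e) * 2 ^ t + g) XOR fa c =
      ((d XOR p1 (fa c)) * 2 ^ m + (e XOR p2 (fa c))) * 2 ^ t + (g XOR p3 (fa c))"
    if "e < 2 ^ m" "g < 2 ^ t" "c < 2 ^ ?N" for d e g c
  proof -
    note b = p[OF f(1)[OF that(3)]]
    have "((d * 2 ^ m + e) * 2 ^ t + g) XOR ((p1 (fa c) * 2 ^ m + p2 (fa c)) * 2 ^ t + p3 (fa c)) =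
      ((d * 2 ^ m + e) XOR (p1 (fa c) * 2 ^ m + p2 (fa c))) * 2 ^ t + (g XOR p3 (fa c))"
      by (rule xor_concat[OF that(2) b(3)])
    also have "(d * 2 ^ m + e) XOR (p1 (fa c) * 2 ^ m + p2 (fa c)) =
      (d XOR p1 (fa c)) * 2 ^ m + (e XOR p2 (fa c))" by (rule xor_concat[OF that(1) b(2)])
    finally show ?thesis unfolding pi .
  qed
  have wcharN: "wchar ?N (fc c) ((d * 2 ^ m + e) * 2 ^ t + g) =
      wchar n (p1 (fc c)) d * wchar m (p2 (fc c)) e * wchar t (p3 (fc c)) g"
    if "e < 2 ^ m" "g < 2 ^ t" "c < 2 ^ ?N" for d e g c
  proof -
    note b = p[OF f(2)[OF that(3)]]
    have "wchar ?N ((p1 (fc c) * 2 ^ m + p2 (fc c)) * 2 ^ t + p3 (fc c)) ((d * 2 ^ m + e) * 2 ^ t + g) =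
      wchar (n + m) (p1 (fc c) * 2 ^ m + p2 (fc c)) (d * 2 ^ m + e) * wchar t (p3 (fc c)) g"
      by (rule wchar_concat[OF that(2) b(3)])
    then show ?thesis unfolding pi wchar_concat[OF that(1) b(2)] .
  qed
  have pauliN: "pauli ?N (fa c) (fc c) $$ ((d * 2 ^ m + e) * 2 ^ t + g, (d' * 2 ^ m + e') * 2 ^ t + g') =
      pauli n (p1 (fa c)) (p1 (fc c)) $$ (d, d') * pauli m (p2 (fa c)) (p2 (fc c)) $$ (e, e') *
      pauli t (p3 (fa c)) (p3 (fc c)) $$ (g, g')"
    if "d < 2 ^ n" "d' < 2 ^ n" "e < 2 ^ m" "e' < 2 ^ m" "g < 2 ^ t" "g' < 2 ^ t" "c < 2 ^ ?N" for d d' e e' g g' c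
  proof -
    note b = p[OF f(1)[OF that(7)]] p[OF f(2)[OF that(7)]]
    have "pauli ?N ((p1 (fa c) * 2 ^ m + p2 (fa c)) * 2 ^ t + p3 (fa c)) ((p1 (fc c) * 2 ^ m + p2 (fc c)) * 2 ^ t + p3 (fc c)) $$
        ((d * 2 ^ m + e) * 2 ^ t + g, (d' * 2 ^ m + e') * 2 ^ t + g') =
      pauli (n + m) (p1 (fa c) * 2 ^ m + p2 (fa c)) (p1 (fc c) * 2 ^ m + p2 (fc c)) $$ (d * 2 ^ m + e, d' * 2 ^ m + e') *
      pauli t (p3 (fa c)) (p3 (fc c)) $$ (g, g')"
      by (rule pauli_concat) (use that b in \<open>auto intro: concat_less_exp\<close>)
    also have "pauli (n + m) (p1 (fa c) * 2 ^ m + p2 (fa c)) (p1 (fc c) * 2 ^ m + p2 (fc c)) $$ (d * 2 ^ m + e, d' * 2 ^ m + e') =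
      pauli n (p1 (fa c)) (p1 (fc c)) $$ (d, d') * pauli m (p2 (fa c)) (p2 (fc c)) $$ (e, e')"
      by (rule pauli_concat) (use that b in auto)
    finally show ?thesis unfolding pi .
  qed
  have idx: "(d * 2 ^ m + e) * 2 ^ t + g < 2 ^ ?N" if "d < 2 ^ n" "e < 2 ^ m" "g < 2 ^ t" for d e g :: nat
    by (intro concat_less_exp that)
  show thesis
  proof (rule that[of J "\<lambda>c. p1 (fa c)" "\<lambda>c. p1 (fc c)" "\<lambda>c. p3 (fa c)" "\<lambda>c. p3 (fc c)"
        "\<lambda>B c. wchar ?N c B * ph c * r c / 2 ^ ?N"])
    show "finite J" by (simp add: J_def)
    show "p1 (fa j) < 2 ^ n \<and> p1 (fc j) < 2 ^ n \<and> p3 (fa j) < 2 ^ t \<and> p3 (fc j) < 2 ^ t" if "j \<in> J" for j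
      using that p f by (simp add: J_def)
  next
    fix j B :: nat assume "j \<in> J" and B: "B < 2 ^ ?N"
    then have j: "j < 2 ^ ?N" "r j \<noteq> 0" by (auto simp: J_def)
    obtain s where s: "cmod s = 1" "\<And>e. e < 2 ^ m \<Longrightarrow>
        cnj (\<phi> (e XOR p2 (fa j))) * wchar m (p2 (fc j)) e = s * cnj (\<phi> e)"
      using \<phi>[OF p(2)[OF f(1)[OF j(1)]] p(2)[OF f(2)[OF j(1)]]] j(2) unfolding r_def by blast
    show "\<exists>ph. cmod ph = 1 \<and> (\<forall>d<2 ^ n. \<forall>g<2 ^ t. v B d g = ph * (wchar n (p1 (fc j)) (d XOR p1 (fa j)) *
        wchar t (p3 (fc j)) (g XOR p3 (fa j)) * v B (d XOR p1 (fa j)) (g XOR p3 (fa j))))"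
    proof (intro exI[of _ "wchar ?N j B * ph j * s"] conjI allI impI)
      show "cmod (wchar ?N j B * ph j * s) = 1" using s ph[OF j(1)] by (simp add: norm_mult)
      fix d g :: nat assume dg: "d < 2 ^ n" "g < 2 ^ t"
      let ?d = "d XOR p1 (fa j)" and ?g = "g XOR p3 (fa j)"
      have g': "?g < 2 ^ t" by (rule xor_nat_less_exp[OF dg(2) p(3)[OF f(1)[OF j(1)]]])
      have "wchar ?N j B * v B d g = (\<Sum>e<2 ^ m. cnj (\<phi> e) * (wchar ?N j B * W $$ ((d * 2 ^ m + e) * 2 ^ t + g, B)))"
        by (simp add: v_def partial_contract_def sum_distrib_left mult_ac)
      also have "\<dots> = (\<Sum>e<2 ^ m. ph j * wchar n (p1 (fc j)) ?d * wchar t (p3 (fc j)) ?g *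
          (cnj (\<phi> e) * wchar m (p2 (fc j)) (e XOR p2 (fa j)) * W $$ ((?d * 2 ^ m + (e XOR p2 (fa j))) * 2 ^ t + ?g, B)))"
      proof (rule sum.cong)
        fix e assume "e \<in> {..<(2::nat) ^ m}"
        then have e: "e < 2 ^ m" "e XOR p2 (fa j) < 2 ^ m"
          using p(2)[OF f(1)[OF j(1)]] by (auto intro: xor_nat_less_exp)
        show "cnj (\<phi> e) * (wchar ?N j B * W $$ ((d * 2 ^ m + e) * 2 ^ t + g, B)) =
          ph j * wchar n (p1 (fc j)) ?d * wchar t (p3 (fc j)) ?g *
          (cnj (\<phi> e) * wchar m (p2 (fc j)) (e XOR p2 (fa j)) * W $$ ((?d * 2 ^ m + (e XOR p2 (fa j))) * 2 ^ t + ?g, B))"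
          unfolding stab[OF j(1) idx[OF dg(1) e(1) dg(2)] B] xorN[OF e(1) dg(2) j(1)] wcharN[OF e(2) g' j(1)]
          by (simp add: mult_ac)
      qed simp
      \<comment> \<open>Writing \<open>e\<close> as a double shift lets the sum be translated, which
        moves the ancilla Pauli from the column onto <\<phi>|.\<close>
      also have "\<dots> = ph j * wchar n (p1 (fc j)) ?d * wchar t (p3 (fc j)) ?g *
        (\<Sum>e<2 ^ m. cnj (\<phi> ((e XOR p2 (fa j)) XOR p2 (fa j))) * wchar m (p2 (fc j)) (e XOR p2 (fa j)) *
           W $$ ((?d * 2 ^ m + (e XOR p2 (fa j))) * 2 ^ t + ?g, B))"
        by (simp add: sum_distrib_left)
      also have "(\<Sum>e<2 ^ m. cnj (\<phi> ((e XOR p2 (fa j)) XOR p2 (fa j))) * wchar m (p2 (fc j)) (e XOR p2 (fa j)) *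
           W $$ ((?d * 2 ^ m + (e XOR p2 (fa j))) * 2 ^ t + ?g, B)) =
         (\<Sum>e<2 ^ m. cnj (\<phi> (e XOR p2 (fa j))) * wchar m (p2 (fc j)) e * W $$ ((?d * 2 ^ m + e) * 2 ^ t + ?g, B))"
        by (rule sum_xor_reindex[OF p(2)[OF f(1)[OF j(1)]]])
      also have "\<dots> = s * v B ?d ?g"
        unfolding v_def partial_contract_def sum_distrib_left
        by (rule sum.cong) (simp_all add: s(2) mult.assoc)
      finally have "wchar ?N j B * (wchar ?N j B * v B d g) =
        wchar ?N j B * (ph j * wchar n (p1 (fc j)) ?d * wchar t (p3 (fc j)) ?g * (s * v B ?d ?g))" by simp
      then show "v B d g = wchar ?N j B * ph j * s * (wchar n (p1 (fc j)) ?d * wchar t (p3 (fc j)) ?g * v B ?d ?g)"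
        by (simp add: mult_ac)
    qed
  next
    fix B d d' g g' :: nat
    assume *: "B < 2 ^ ?N" "d < 2 ^ n" "d' < 2 ^ n" "g < 2 ^ t" "g' < 2 ^ t"
    have r_alt: "r c = (\<Sum>e<2 ^ m. \<Sum>e'<2 ^ m. cnj (\<phi> e) * \<phi> e' * pauli m (p2 (fa c)) (p2 (fc c)) $$ (e, e'))"
      if "c < 2 ^ ?N" for c
    proof -
      have a: "p2 (fa c) < 2 ^ m" using p(2)[OF f(1)[OF that]] .
      have "(\<Sum>e<2 ^ m. \<Sum>e'<2 ^ m. cnj (\<phi> e) * \<phi> e' * pauli m (p2 (fa c)) (p2 (fc c)) $$ (e, e')) =
        (\<Sum>e'<2 ^ m. \<Sum>e<2 ^ m. if e = e' XOR p2 (fa c)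
           then cnj (\<phi> (e' XOR p2 (fa c))) * wchar m (p2 (fc c)) e' * \<phi> e' else 0)"
        by (subst sum.swap, intro sum.cong) (auto simp: pauli_index)
      also have "\<dots> = r c"
        unfolding r_def using a by (intro sum.cong) (simp_all add: xor_nat_less_exp)
      finally show ?thesis ..
    qed
    have "2 ^ ?N * (v B d g * cnj (v B d' g')) = (\<Sum>e<2 ^ m. \<Sum>e'<2 ^ m. cnj (\<phi> e) * \<phi> e' *
       (2 ^ ?N * (W $$ ((d * 2 ^ m + e) * 2 ^ t + g, B) * cnj (W $$ ((d' * 2 ^ m + e') * 2 ^ t + g', B)))))"
      unfolding v_def partial_contract_def cnj_sum sum_product
      unfolding sum_distrib_left by (simp add: mult_ac)
    also have "\<dots> = (\<Sum>e<2 ^ m. \<Sum>e'<2 ^ m. \<Sum>c<2 ^ ?N. wchar ?N c B * ph c * pauli n (p1 (fa c)) (p1 (fc c)) $$ (d, d') *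
        pauli t (p3 (fa c)) (p3 (fc c)) $$ (g, g') * (cnj (\<phi> e) * \<phi> e' * pauli m (p2 (fa c)) (p2 (fc c)) $$ (e, e')))"
    proof (intro sum.cong refl)
      fix e e' assume "e \<in> {..<(2::nat) ^ m}" "e' \<in> {..<(2::nat) ^ m}"
      then have e: "e < 2 ^ m" "e' < 2 ^ m" by auto
      show "cnj (\<phi> e) * \<phi> e' *
          (2 ^ ?N * (W $$ ((d * 2 ^ m + e) * 2 ^ t + g, B) * cnj (W $$ ((d' * 2 ^ m + e') * 2 ^ t + g', B)))) =
        (\<Sum>c<2 ^ ?N. wchar ?N c B * ph c * pauli n (p1 (fa c)) (p1 (fc c)) $$ (d, d') *
          pauli t (p3 (fa c)) (p3 (fc c)) $$ (g, g') * (cnj (\<phi> e) * \<phi> e' * pauli m (p2 (fa c)) (p2 (fc c)) $$ (e, e')))"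
        unfolding proj[OF idx[OF *(2) e(1) *(4)] idx[OF *(3) e(2) *(5)] *(1)] sum_distrib_left
        by (rule sum.cong[OF refl], subst pauliN[OF *(2,3) e *(4,5)]) (simp_all add: mult_ac)
    qed
    also have "\<dots> = (\<Sum>c<2 ^ ?N. wchar ?N c B * ph c * pauli n (p1 (fa c)) (p1 (fc c)) $$ (d, d') *
        pauli t (p3 (fa c)) (p3 (fc c)) $$ (g, g') * r c)"
    proof -
      have "(\<Sum>e\<in>A. \<Sum>e'\<in>A. \<Sum>c\<in>X. F e e' c) = (\<Sum>c\<in>X. \<Sum>e\<in>A. \<Sum>e'\<in>A. F e e' c)"
        for F :: "nat \<Rightarrow> nat \<Rightarrow> nat \<Rightarrow> complex" and A X
        by (rule trans[OF sum.cong[OF refl sum.swap] sum.swap])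
      then show ?thesis by (simp add: r_alt sum_distrib_left)
    qed
    also have "\<dots> = (\<Sum>c\<in>J. wchar ?N c B * ph c * pauli n (p1 (fa c)) (p1 (fc c)) $$ (d, d') *
        pauli t (p3 (fa c)) (p3 (fc c)) $$ (g, g') * r c)"
      by (rule sum.mono_neutral_right) (auto simp: J_def)
    finally have "v B d g * cnj (v B d' g') = (\<Sum>c\<in>J. wchar ?N c B * ph c * pauli n (p1 (fa c)) (p1 (fc c)) $$ (d, d') *
        pauli t (p3 (fa c)) (p3 (fc c)) $$ (g, g') * r c) / 2 ^ ?N" by (simp add: field_simps)
    then show "v B d g * cnj (v B d' g') = (\<Sum>j\<in>J. wchar ?N j B * ph j * r j / 2 ^ ?N *
        pauli n (p1 (fa j)) (p1 (fc j)) $$ (d, d') * pauli t (p3 (fa j)) (p3 (fc j)) $$ (g, g'))"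
      by (simp add: sum_divide_distrib mult_ac)
  qed
qed

subsection \<open>Counting Paulis by Parseval\<close>

lemma walsh_parseval:
  fixes y :: "nat \<Rightarrow> complex"
  assumes "a < 2 ^ n"
  shows "(\<Sum>c<2 ^ n. (cmod (\<Sum>d<2 ^ n. wchar n c (d XOR a) * y d))\<^sup>2) = 2 ^ n * (\<Sum>d<2 ^ n. (cmod (y d))\<^sup>2)"
proof -
  have xor0: "d XOR d' = 0 \<longleftrightarrow> d = d'" for d d' :: nat using xor_nat_eq_iff[of 0 d d'] by auto
  have "(\<Sum>c<2 ^ n. (\<Sum>d<2 ^ n. wchar n c (d XOR a) * y d) * cnj (\<Sum>d<2 ^ n. wchar n c (d XOR a) * y d)) =
      (\<Sum>c<2 ^ n. \<Sum>d<2 ^ n. \<Sum>d'<2 ^ n. y d * cnj (y d') * wchar n c (d XOR d'))"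
    unfolding cnj_sum sum_product by (intro sum.cong refl) (simp add: wchar_xor mult_ac)
  also have "\<dots> = (\<Sum>d<2 ^ n. \<Sum>d'<2 ^ n. y d * cnj (y d') * (\<Sum>c<2 ^ n. wchar n c (d XOR d')))"
    unfolding sum_distrib_left
    by (subst sum.swap, rule sum.cong[OF refl], rule sum.swap)
  also have "\<dots> = (\<Sum>d<2 ^ n. \<Sum>d'<2 ^ n. if d' = d then 2 ^ n * (y d * cnj (y d)) else 0)"
    by (intro sum.cong refl) (simp add: sum_wchar xor_nat_less_exp xor0)
  also have "\<dots> = 2 ^ n * (\<Sum>d<2 ^ n. y d * cnj (y d))"
    by (simp add: sum_distrib_left)
  finally have "complex_of_real (\<Sum>c<2 ^ n. (cmod (\<Sum>d<2 ^ n. wchar n c (d XOR a) * y d))\<^sup>2) =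
      complex_of_real (2 ^ n * (\<Sum>d<2 ^ n. (cmod (y d))\<^sup>2))"
    unfolding mult_cnj_eq_norm by simp
  then show ?thesis unfolding of_real_eq_iff .
qed

text \<open>The inner sum is the Hilbert-Schmidt product of \<open>M\<close> with the real matrix
  \<open>pauli n a c\<close>. These 4^n matrices are orthogonal with squared norm 2^n, whence the
  factor on the right.\<close>

lemma pauli_parseval:
  fixes M :: "nat \<Rightarrow> nat \<Rightarrow> complex"
  shows "(\<Sum>a<2 ^ n. \<Sum>c<2 ^ n. (cmod (\<Sum>d<2 ^ n. wchar n c (d XOR a) * M d (d XOR a)))\<^sup>2) =
    2 ^ n * (\<Sum>d<2 ^ n. \<Sum>d'<2 ^ n. (cmod (M d d'))\<^sup>2)"
proof -
  have "(\<Sum>a<2 ^ n. \<Sum>c<2 ^ n. (cmod (\<Sum>d<2 ^ n. wchar n c (d XOR a) * M d (d XOR a)))\<^sup>2) =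
    (\<Sum>a<2 ^ n. 2 ^ n * (\<Sum>d<2 ^ n. (cmod (M d (d XOR a)))\<^sup>2))"
    by (intro sum.cong refl walsh_parseval) simp
  also have "\<dots> = 2 ^ n * (\<Sum>d<2 ^ n. \<Sum>a<2 ^ n. (cmod (M d (a XOR d)))\<^sup>2)"
    unfolding sum_distrib_left[symmetric] by (subst sum.swap) (simp add: xor.commute)
  also have "(\<Sum>d<2 ^ n. \<Sum>a<2 ^ n. (cmod (M d (a XOR d)))\<^sup>2) = (\<Sum>d<2 ^ n. \<Sum>d'<2 ^ n. (cmod (M d d'))\<^sup>2)"
    by (intro sum.cong refl sum_xor_reindex) simp
  finally show ?thesis .
qed

text \<open>For \<open>M\<close> the partial trace over the gadgets of \<open>(I \<otimes> Q)|v><v|\<close>, maximal entanglement fixes the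
  Hilbert-Schmidt norm of \<open>M\<close>, while every \<open>P\<close> with \<open>(P \<otimes> Q)v\<close> a phase times \<open>v\<close> contributes
  \<open>\<parallel>v\<parallel>^4\<close> to the Parseval sum.\<close>

lemma card_stabilizing_paulis:
  fixes v :: "nat \<Rightarrow> nat \<Rightarrow> complex" and \<kappa> :: real
  assumes ent: "\<And>g g'. g < 2 ^ t \<Longrightarrow> g' < 2 ^ t \<Longrightarrow>
      (\<Sum>d<2 ^ n. v d g * cnj (v d g')) = (if g = g' then complex_of_real \<kappa> else 0)"
    and "\<kappa> \<noteq> 0" and b: "b < 2 ^ t"
    and S: "S \<subseteq> {..<2 ^ n} \<times> {..<2 ^ n}"
    and stab: "\<And>a c. (a, c) \<in> S \<Longrightarrow> \<exists>ph. cmod ph = 1 \<and> (\<forall>d<2 ^ n. \<forall>g<2 ^ t.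
      v d g = ph * (wchar n c (d XOR a) * wchar t f (g XOR b) * v (d XOR a) (g XOR b)))"
  shows "card S * 2 ^ t \<le> 2 ^ n"
proof -
  \<comment> \<open>\<open>u\<close> is (I \<otimes> Q)v with Q labelled by \<open>b\<close> and
    \<open>f\<close>, \<open>M\<close> is the transposed partial trace of |u><v| over the gadgets,
    and \<open>T a c\<close> is a Pauli coefficient of \<open>M\<close>.\<close>
  define u where "u = (\<lambda>d g. wchar t f (g XOR b) * v d (g XOR b))"
  define M where "M = (\<lambda>d d'. \<Sum>g<2 ^ t. cnj (v d g) * u d' g)"
  define T where "T = (\<lambda>a c. \<Sum>d<2 ^ n. wchar n c (d XOR a) * M d (d XOR a))"
  have u: "(\<Sum>d<2 ^ n. u d g * cnj (u d g)) = complex_of_real \<kappa>" if "g < 2 ^ t" for g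
  proof -
    have "(\<Sum>d<2 ^ n. u d g * cnj (u d g)) = (\<Sum>d<2 ^ n. v d (g XOR b) * cnj (v d (g XOR b)))"
      by (rule sum.cong) (simp_all add: u_def mult_ac)
    then show ?thesis using ent[of "g XOR b" "g XOR b"] that b by (simp add: xor_nat_less_exp)
  qed
  \<comment> \<open>Regrouped by gadget indices, the norm is a sum of products of Gram matrix
    entries of \<open>v\<close> and of \<open>u\<close>. The Gram matrix of \<open>v\<close> is
    \<kappa> times the identity, so only \<open>g = h\<close> remains.\<close>
  have "complex_of_real (\<Sum>d<2 ^ n. \<Sum>d'<2 ^ n. (cmod (M d d'))\<^sup>2) = (\<Sum>d<2 ^ n. \<Sum>d'<2 ^ n. M d d' * cnj (M d d'))"
    by (simp add: mult_cnj_eq_norm)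
  also have "\<dots> = (\<Sum>d<2 ^ n. \<Sum>d'<2 ^ n. \<Sum>g<2 ^ t. \<Sum>h<2 ^ t. (v d h * cnj (v d g)) * (u d' g * cnj (u d' h)))"
    unfolding M_def cnj_sum sum_product by (intro sum.cong refl) (simp add: mult_ac)
  also have "\<dots> = (\<Sum>g<2 ^ t. \<Sum>h<2 ^ t. (\<Sum>d<2 ^ n. v d h * cnj (v d g)) * (\<Sum>d'<2 ^ n. u d' g * cnj (u d' h)))"
  proof -
    have "(\<Sum>d\<in>A. \<Sum>d'\<in>A. \<Sum>g\<in>X. \<Sum>h\<in>X. F d g h * G d' g h) = (\<Sum>g\<in>X. \<Sum>h\<in>X. (\<Sum>d\<in>A. F d g h) * (\<Sum>d'\<in>A. G d' g h))"
      for F G :: "nat \<Rightarrow> nat \<Rightarrow> nat \<Rightarrow> complex" and A X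
    proof -
      have swap: "(\<Sum>d\<in>A. \<Sum>g\<in>X. \<Sum>h\<in>X. H d g h) = (\<Sum>g\<in>X. \<Sum>h\<in>X. \<Sum>d\<in>A. H d g h)"
        for H :: "nat \<Rightarrow> nat \<Rightarrow> nat \<Rightarrow> complex"
        by (rule trans[OF sum.swap sum.cong[OF refl sum.swap]])
      have "(\<Sum>d\<in>A. \<Sum>d'\<in>A. \<Sum>g\<in>X. \<Sum>h\<in>X. F d g h * G d' g h) =
          (\<Sum>d\<in>A. \<Sum>g\<in>X. \<Sum>h\<in>X. \<Sum>d'\<in>A. F d g h * G d' g h)"
        by (intro sum.cong refl swap)
      also have "\<dots> = (\<Sum>g\<in>X. \<Sum>h\<in>X. (\<Sum>d\<in>A. F d g h) * (\<Sum>d'\<in>A. G d' g h))"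
        unfolding swap sum_product ..
      finally show ?thesis .
    qed
    then show ?thesis .
  qed
  also have "\<dots> = (\<Sum>g<(2::nat) ^ t. \<Sum>h<2 ^ t. if h = g then complex_of_real \<kappa> * complex_of_real \<kappa> else 0)"
    by (intro sum.cong refl) (simp add: ent u)
  also have "\<dots> = complex_of_real (2 ^ t * \<kappa>\<^sup>2)" by (simp add: power2_eq_square)
  finally have M: "(\<Sum>d<2 ^ n. \<Sum>d'<2 ^ n. (cmod (M d d'))\<^sup>2) = 2 ^ t * \<kappa>\<^sup>2"
    unfolding of_real_eq_iff .
  have T: "(cmod (T a c))\<^sup>2 = (2 ^ t * \<kappa>)\<^sup>2" if ac: "(a, c) \<in> S" for a c
  proof -
    obtain ph where ph: "cmod ph = 1" "\<And>d g. d < 2 ^ n \<Longrightarrow> g < 2 ^ t \<Longrightarrow>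
      v d g = ph * (wchar n c (d XOR a) * wchar t f (g XOR b) * v (d XOR a) (g XOR b))"
      using stab[OF ac] by blast
    \<comment> \<open>Pairing with the stabilizing Pauli undoes Q up to phase, so the coefficient
      becomes <v|v>.\<close>
    have "ph * T a c = (\<Sum>d<2 ^ n. \<Sum>g<2 ^ t. v d g * cnj (v d g))"
      unfolding T_def M_def sum_distrib_left
    proof (intro sum.cong refl)
      fix d g assume "d \<in> {..<(2::nat) ^ n}" "g \<in> {..<(2::nat) ^ t}"
      then have "v d g = ph * (wchar n c (d XOR a) * wchar t f (g XOR b) * v (d XOR a) (g XOR b))"
        by (intro ph) auto
      then have "v d g * cnj (v d g) = ph * (wchar n c (d XOR a) * wchar t f (g XOR b) * v (d XOR a) (g XOR b)) * cnj (v d g)"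
        by simp
      from this[symmetric] show "ph * (wchar n c (d XOR a) * (cnj (v d g) * u (d XOR a) g)) = v d g * cnj (v d g)"
        by (simp only: u_def mult_ac)
    qed
    also have "\<dots> = (\<Sum>g<2 ^ t. \<Sum>d<2 ^ n. v d g * cnj (v d g))" by (rule sum.swap)
    also have "\<dots> = complex_of_real (2 ^ t * \<kappa>)" by (simp add: ent)
    finally have "cmod (ph * T a c) = \<bar>2 ^ t * \<kappa>\<bar>" by (simp only: norm_of_real)
    then have "cmod (T a c) = \<bar>2 ^ t * \<kappa>\<bar>" using ph by (simp add: norm_mult)
    then show ?thesis by (simp only: power2_abs)
  qed
  have "real (card S) * (2 ^ t * \<kappa>)\<^sup>2 = (\<Sum>(a, c)\<in>S. (cmod (T a c))\<^sup>2)"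
    using T by (simp add: split_def)
  also have "\<dots> \<le> (\<Sum>(a, c)\<in>{..<2 ^ n} \<times> {..<2 ^ n}. (cmod (T a c))\<^sup>2)"
    by (rule sum_mono2) (use S in auto)
  also have "\<dots> = 2 ^ n * (2 ^ t * \<kappa>\<^sup>2)"
    unfolding sum.cartesian_product[symmetric] T_def pauli_parseval M ..
  finally have "real (card S) * 2 ^ t * (2 ^ t * \<kappa>\<^sup>2) \<le> 2 ^ n * (2 ^ t * \<kappa>\<^sup>2)"
    by (simp add: power2_eq_square mult_ac)
  then have "real (card S) * 2 ^ t \<le> 2 ^ n"
    using \<open>\<kappa> \<noteq> 0\<close> by (simp add: mult_le_cancel_right)
  then have "real (card S * 2 ^ t) \<le> real (2 ^ n)" by simp
  then show ?thesis unfolding of_nat_le_iff .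
qed

subsection \<open>Pauli expectations of the magic state\<close>

text \<open>Where both indices agree, a common flip multiplies the two amplitudes by conjugate
  phases.\<close>

lemma tphase_xor_pair:
  assumes "k < t" "bit x k = bit y k"
  shows "cnj (tphase t (x XOR 2 ^ k)) * tphase t (y XOR 2 ^ k) = cnj (tphase t x) * tphase t y"
proof -
  have u: "cnj (cis (pi / 4)) * cis (pi / 4) = 1" by (simp add: cis_cnj cis_mult)
  have *: "cnj (tphase t (x XOR 2 ^ k)) * tphase t (y XOR 2 ^ k) = cnj (tphase t x) * tphase t y"
    if "\<not> bit x k" "\<not> bit y k" for x y
  proof -
    have "cnj (tphase t (x XOR 2 ^ k)) * tphase t (y XOR 2 ^ k) =
      (cnj (cis (pi / 4)) * cis (pi / 4)) * (cnj (tphase t x) * tphase t y)"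
      using that by (simp add: tphase_xor assms(1) mult_ac del: cis_cnj)
    then show ?thesis using u by simp
  qed
  show ?thesis
  proof (cases "bit x k")
    case False
    then show ?thesis using * assms by simp
  next
    case True
    then have "\<not> bit (x XOR 2 ^ k) k" "\<not> bit (y XOR 2 ^ k) k" using assms by (auto simp: bit_simps)
    from *[OF this] show ?thesis by simp
  qed
qed

text \<open>Position \<open>k\<close> carries Z without X, so \<open>g\<close> and
  \<open>g XOR a\<close> agree there. Flipping that bit keeps the product of amplitudes but negates
  the character, and the terms cancel in pairs.\<close>

lemma tphase_pauli_vanish:
  assumes "a < 2 ^ t" "k < t" "bit c k" "\<not> bit a k"
  shows "(\<Sum>g<2 ^ t. \<Sum>g'<2 ^ t. cnj (tphase t g) * tphase t g' * pauli t a c $$ (g, g')) = 0"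
proof -
  define F where "F = (\<lambda>g. cnj (tphase t (g XOR a)) * tphase t g * wchar t c g)"
  have "(\<Sum>g<2 ^ t. \<Sum>g'<2 ^ t. cnj (tphase t g) * tphase t g' * pauli t a c $$ (g, g')) =
    (\<Sum>g'<2 ^ t. \<Sum>g<2 ^ t. if g = g' XOR a then F g' else 0)"
    by (subst sum.swap, intro sum.cong refl) (auto simp: pauli_index F_def)
  also have "\<dots> = (\<Sum>g<2 ^ t. F g)"
    using assms(1) by (intro sum.cong) (simp_all add: xor_nat_less_exp)
  also have "\<dots> = 0"
  proof -
    have "F (g XOR 2 ^ k) = - F g" for g
    proof -
      have "(g XOR 2 ^ k) XOR a = (g XOR a) XOR 2 ^ k" by (simp add: xor.assoc xor.commute xor.left_commute)
      moreover have "bit (g XOR a) k = bit g k" using assms by (simp add: bit_simps)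
      ultimately have "cnj (tphase t ((g XOR 2 ^ k) XOR a)) * tphase t (g XOR 2 ^ k) = cnj (tphase t (g XOR a)) * tphase t g"
        using tphase_xor_pair[OF assms(2)] by simp
      moreover have "wchar t c (g XOR 2 ^ k) = - wchar t c g"
        using assms by (simp add: wchar_xor wchar_commute[of t c "2 ^ k"] wchar_power2)
      ultimately show ?thesis by (simp add: F_def)
    qed
    then have "(\<Sum>g<2 ^ t. F g) = - (\<Sum>g<2 ^ t. F g)"
      using sum_xor_reindex[of "2 ^ k" t F] assms(2) by (simp add: sum_negf)
    then show ?thesis by simp
  qed
  finally show ?thesis .
qed

text \<open>The labels of tensor products of \<open>I\<close>, \<open>X\<close> and \<open>Y\<close>: no \<open>Z\<close> without an \<open>X\<close>.\<close>

definition xy_paulis :: "nat \<Rightarrow> (nat \<times> nat) set" where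
  "xy_paulis t = {(a, c). a < 2 ^ t \<and> c < 2 ^ t \<and> (\<forall>k. bit c k \<longrightarrow> bit a k)}"

lemma finite_xy_paulis: "finite (xy_paulis t)"
  by (rule finite_subset[of _ "{..<2 ^ t} \<times> {..<2 ^ t}"]) (auto simp: xy_paulis_def)

text \<open>Halving both labels splits off the lowest tensor factor, for which only three pairs of
  bits are allowed.\<close>

lemma card_xy_paulis: "card (xy_paulis t) \<le> 3 ^ t"
proof (induction t)
  case 0
  have "xy_paulis 0 \<subseteq> {(0, 0)}" by (auto simp: xy_paulis_def)
  then show ?case using card_mono[of "{(0::nat, 0::nat)}"] by simp
next
  case (Suc t)
  define f where "f = (\<lambda>(a::nat, c::nat). ((a div 2, c div 2), (a mod 2, c mod 2)))"
  let ?D = "{(0, 0), (1, 0), (1, 1)} :: (nat \<times> nat) set"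
  have "inj_on f (xy_paulis (Suc t))"
    unfolding inj_on_def f_def by (auto) (metis div_mult_mod_eq)+
  moreover have "f ` xy_paulis (Suc t) \<subseteq> xy_paulis t \<times> ?D"
  proof
    fix p assume "p \<in> f ` xy_paulis (Suc t)"
    then obtain a c where ac: "(a, c) \<in> xy_paulis (Suc t)" "p = f (a, c)" by auto
    then have b: "a < 2 * 2 ^ t" "c < 2 * 2 ^ t" "\<And>k. bit c k \<Longrightarrow> bit a k" by (auto simp: xy_paulis_def)
    have "bit (c div 2) k \<Longrightarrow> bit (a div 2) k" for k using b(3)[of "Suc k"] by (simp add: bit_Suc)
    then have "(a div 2, c div 2) \<in> xy_paulis t" using b by (auto simp: xy_paulis_def)
    moreover have "odd c \<Longrightarrow> odd a" using b(3)[of 0] by (simp add: bit_0)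
    then have "(a mod 2, c mod 2) \<in> ?D" by (auto simp: mod2_eq_if)
    ultimately show "p \<in> xy_paulis t \<times> ?D" using ac by (simp add: f_def)
  qed
  ultimately have "card (xy_paulis (Suc t)) \<le> card (xy_paulis t \<times> ?D)"
    using finite_xy_paulis by (intro card_inj_on_le) auto
  also have "\<dots> = card (xy_paulis t) * 3" by (simp add: card_cartesian_product)
  finally show ?case using Suc by simp
qed

subsection \<open>The dimension bound\<close>

text \<open>Steinitz exchange in the ambient space: a basis of the smaller span stays linearly
  independent there and is compared with the spanning list \<open>T\<close>, which may itself be
  dependent.\<close>

lemma (in vectorspace) dim_span_le_card:
  assumes "finite S" "finite T" "S \<subseteq> carrier V" "T \<subseteq> carrier V" "S \<subseteq> span T"
  shows "vectorspace.dim K (span_vs S) \<le> card T"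
proof -
  have sub: "VectorSpace.subspace K (span S) V" by (rule span_is_subspace[OF assms(3)])
  then have sm: "submodule K (span S) V" by (simp add: VectorSpace.subspace_def)
  interpret W: vectorspace K "span_vs S" by (rule subspace_is_vs[OF sub])
  have SW: "S \<subseteq> span S" using in_own_span[OF assms(3)] .
  have "W.gen_set S" using span_li_not_depend(1)[OF SW sm] by simp
  then have "W.fin_dim" unfolding W.fin_dim_def using assms(1) SW by auto
  then obtain B where B: "finite B" "W.basis B" using W.finite_basis_exists by blast
  then have BW: "B \<subseteq> span S" and "W.lin_indpt B" by (auto simp: W.basis_def)
  then have li: "lin_indpt B" using span_li_not_depend(2)[OF BW sm] by simp
  have "span S \<subseteq> span T"
    using span_is_subset[OF assms(5) span_is_submodule[OF assms(4)]] by simp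
  then have "B \<subseteq> span T" using BW by blast
  from replacement[OF B(1) assms(2) assms(4) li this] have "card B \<le> card T" by auto
  then show ?thesis using W.dim_basis[OF B] by simp
qed

lemma mat_sum_in_span:
  fixes P :: "'b \<Rightarrow> complex mat"
  assumes "finite J" "\<And>j. j \<in> J \<Longrightarrow> P j \<in> carrier_mat nr nc"
    and "M \<in> carrier_mat nr nc"
    and "\<And>i k. i < nr \<Longrightarrow> k < nc \<Longrightarrow> M $$ (i, k) = (\<Sum>j\<in>J. f j * P j $$ (i, k))"
  shows "M \<in> LinearCombinations.module.span class_ring (module_mat TYPE(complex) nr nc) (P ` J)"
proof -
  interpret V: vectorspace "class_ring :: complex ring" "module_mat TYPE(complex) nr nc"
    by (rule matrix_vs)
  let ?V = "module_mat TYPE(complex) nr nc"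
  have PJ: "P ` J \<subseteq> carrier ?V" using assms(2) by (auto simp: module_mat_simps)
  have sm: "submodule class_ring (V.span (P ` J)) ?V" by (rule V.span_is_submodule[OF PJ])
  have "mat nr nc (\<lambda>p. \<Sum>j\<in>I. f j * P j $$ p) \<in> V.span (P ` J)" if "I \<subseteq> J" for I
    using finite_subset[OF that assms(1)] that
  proof (induction I rule: finite_induct)
    case empty
    have "\<zero>\<^bsub>?V\<^esub> \<in> V.span (P ` J)" using V.span_zero .
    also have "\<zero>\<^bsub>?V\<^esub> = mat nr nc (\<lambda>p. \<Sum>j\<in>{}. f j * P j $$ p)" by (auto simp: module_mat_simps)
    finally show ?case .
  next
    case (insert j I)
    have "P j \<in> V.span (P ` J)" using V.in_own_span[OF PJ] insert by auto
    then have "f j \<odot>\<^bsub>?V\<^esub> P j \<in> V.span (P ` J)"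
      using sm by (simp add: submodule_def)
    then have "(f j \<odot>\<^bsub>?V\<^esub> P j) \<oplus>\<^bsub>?V\<^esub> mat nr nc (\<lambda>p. \<Sum>j\<in>I. f j * P j $$ p) \<in> V.span (P ` J)"
      using V.span_add1[OF PJ] insert by auto
    also have "(f j \<odot>\<^bsub>?V\<^esub> P j) \<oplus>\<^bsub>?V\<^esub> mat nr nc (\<lambda>p. \<Sum>j\<in>I. f j * P j $$ p) =
      mat nr nc (\<lambda>p. \<Sum>j\<in>insert j I. f j * P j $$ p)"
      using insert assms(2)[of j] by (auto simp: module_mat_simps intro!: eq_matI)
    finally show ?case .
  qed
  moreover have "M = mat nr nc (\<lambda>p. \<Sum>j\<in>J. f j * P j $$ p)"
    by (rule eq_matI) (use assms(3,4) in auto)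
  ultimately show ?thesis by simp
qed

lemma s_mu_le_card:
  assumes T: "finite T" "T \<subseteq> carrier_mat (2 ^ n) (2 ^ n)"
    and span: "\<And>b. b < 2 ^ (n + m) \<Longrightarrow> povm_elem n m \<psi> gs C b \<in>
      LinearCombinations.module.span class_ring (module_mat TYPE(complex) (2 ^ n) (2 ^ n)) T"
  shows "s_mu n m \<psi> gs C \<le> card T"
proof -
  interpret V: vectorspace "class_ring :: complex ring" "module_mat TYPE(complex) (2 ^ n) (2 ^ n)"
    by (rule matrix_vs)
  have "finite {povm_elem n m \<psi> gs C b | b. b < 2 ^ (n + m)}"
    by (simp add: setcompr_eq_image flip: lessThan_def)
  then show ?thesis
    unfolding s_mu_def using T span povm_elem_carrier
    by (intro V.dim_span_le_card) (auto simp: module_mat_simps)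
qed

text \<open>Keeping \<open>2 ^ t\<close> on the left leaves the count in the natural numbers,
  without an exponent \<open>n - t\<close>.\<close>

lemma s_mu_bound:
  assumes \<psi>: "dim_vec \<psi> = 2 ^ m" "stabilizer_state m \<psi>"
    and gs: "circuit_ok (n + m) gs" "num_T gs = t"
    and C: "clifford_circuit (n + m) C"
    and ent: "\<And>b. b < 2 ^ (n + m) \<Longrightarrow> proj_state n m t \<psi> gs C b \<noteq> 0\<^sub>m (2 ^ (n + t)) 1 \<Longrightarrow>
       max_entangled n t (proj_state n m t \<psi> gs C b)"
  shows "s_mu n m \<psi> gs C * 2 ^ t \<le> 2 ^ n * 3 ^ t"
proof (cases "\<exists>b<2 ^ (n + m). proj_state n m t \<psi> gs C b \<noteq> 0\<^sub>m (2 ^ (n + t)) 1")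
  case False
  \<comment> \<open>No state is available for the count here, but every POVM element vanishes and
    lies in the span of the empty set.\<close>
  have zero: "povm_elem n m \<psi> gs C b $$ (d, d') = 0" if "b < 2 ^ (n + m)" "d < 2 ^ n" "d' < 2 ^ n" for b d d'
  proof -
    have "contracted_state n m t \<psi> gs C b d = 0"
      using False that by (simp add: contracted_state_def concat_less_exp)
    then show ?thesis by (simp add: povm_elem_index[OF \<psi>(1) C gs that])
  qed
  have "povm_elem n m \<psi> gs C b \<in> LinearCombinations.module.span class_ring
      (module_mat TYPE(complex) (2 ^ n) (2 ^ n)) ((\<lambda>_. 0\<^sub>m (2 ^ n) (2 ^ n)) ` ({} :: nat set))"
    if "b < 2 ^ (n + m)" for b
    by (rule mat_sum_in_span[where f = "\<lambda>_. 0"]) (use povm_elem_carrier zero that in auto)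
  then have "s_mu n m \<psi> gs C \<le> card ({} :: complex mat set)"
    by (intro s_mu_le_card) auto
  then show ?thesis by simp
next
  case True
  \<comment> \<open>The labels are shared by all outcomes, so counting them at one outcome with
    nonzero state bounds the span of all POVM elements.\<close>
  then obtain b0 where b0: "b0 < 2 ^ (n + m)" "proj_state n m t \<psi> gs C b0 \<noteq> 0\<^sub>m (2 ^ (n + t)) 1" by blast
  define W where "W = heis (n + m) t gs C"
  define v where "v = (\<lambda>B. partial_contract m t (\<lambda>e. \<psi> $ e) (\<lambda>i. W $$ (i, B)))"
  have v_eq: "v B d g = partial_contract m t (\<lambda>e. \<psi> $ e) (\<lambda>i. W $$ (i, B)) d g" for B d g
    by (simp add: v_def)
  have W: "clifford (n + m + t) W" unfolding W_def by (rule clifford_heis) (use gs C in auto)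
  have v: "proj_state n m t \<psi> gs C b $$ (d * 2 ^ t + g, 0) = v (b * 2 ^ t) d g"
    if "b < 2 ^ (n + m)" "d < 2 ^ n" "g < 2 ^ t" for b d g
    unfolding proj_state_index[OF \<psi>(1) C that] v_def partial_contract_def W_def ..
  have col: "b * 2 ^ t < 2 ^ (n + m + t)" if "b < 2 ^ (n + m)" for b :: nat
    using concat_less_exp[OF that, of 0 t] by simp
  obtain J :: "nat set" and a1 c1 a3 c3 coef where J: "finite J"
    and lt: "\<And>j. j \<in> J \<Longrightarrow> a1 j < 2 ^ n \<and> c1 j < 2 ^ n \<and> a3 j < 2 ^ t \<and> c3 j < 2 ^ t"
    and stab: "\<And>j B. j \<in> J \<Longrightarrow> B < 2 ^ (n + m + t) \<Longrightarrow> \<exists>ph. cmod ph = 1 \<and> (\<forall>d<2 ^ n. \<forall>g<2 ^ t.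
       v B d g = ph * (wchar n (c1 j) (d XOR a1 j) * wchar t (c3 j) (g XOR a3 j) * v B (d XOR a1 j) (g XOR a3 j)))"
    and expand: "\<And>B d d' g g'. B < 2 ^ (n + m + t) \<Longrightarrow> d < 2 ^ n \<Longrightarrow> d' < 2 ^ n \<Longrightarrow> g < 2 ^ t \<Longrightarrow> g' < 2 ^ t \<Longrightarrow>
       v B d g * cnj (v B d' g') =
       (\<Sum>j\<in>J. coef B j * pauli n (a1 j) (c1 j) $$ (d, d') * pauli t (a3 j) (c3 j) $$ (g, g'))"
    by (rule projected_column_paulis[OF W stabilizer_state_expectation[OF \<psi>(2)] v_eq],
        assumption, assumption, rule that)

  \<comment> \<open>The data labels occurring together with gadget label \<open>q\<close>; passing
    to a set merges indices of \<open>J\<close> with equal labels.\<close>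
  define S where "S = (\<lambda>q. (\<lambda>j. (a1 j, c1 j)) ` {j \<in> J. (a3 j, c3 j) = q})"
  \<comment> \<open>The eigenvalue of the reduced state on the gadgets: the squared norm shared
    equally among 2^t basis vectors.\<close>
  define \<kappa> where "\<kappa> = (\<Sum>i<2 ^ (n + t). (cmod (proj_state n m t \<psi> gs C b0 $$ (i, 0)))\<^sup>2) / 2 ^ t"
  have ent0: "(\<Sum>d<2 ^ n. v (b0 * 2 ^ t) d g * cnj (v (b0 * 2 ^ t) d g')) = (if g = g' then complex_of_real \<kappa> else 0)"
    if "g < 2 ^ t" "g' < 2 ^ t" for g g'
  proof -
    have "(\<Sum>d<2 ^ n. v (b0 * 2 ^ t) d g * cnj (v (b0 * 2 ^ t) d g')) =
      (\<Sum>d<2 ^ n. proj_state n m t \<psi> gs C b0 $$ (d * 2 ^ t + g, 0) * cnj (proj_state n m t \<psi> gs C b0 $$ (d * 2 ^ t + g', 0)))"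
      by (intro sum.cong refl) (simp add: v b0 that)
    then show ?thesis using ent[OF b0] that unfolding max_entangled_def \<kappa>_def by simp
  qed
  have \<kappa>: "\<kappa> \<noteq> 0"
  proof
    assume "\<kappa> = 0"
    then have "(\<Sum>i<2 ^ (n + t). (cmod (proj_state n m t \<psi> gs C b0 $$ (i, 0)))\<^sup>2) = 0"
      by (simp add: \<kappa>_def)
    then have z: "proj_state n m t \<psi> gs C b0 $$ (i, 0) = 0" if "i < 2 ^ (n + t)" for i
      using that by (subst (asm) sum_nonneg_eq_0_iff) auto
    have "proj_state n m t \<psi> gs C b0 = 0\<^sub>m (2 ^ (n + t)) 1"
      using z carrier_matD[OF proj_state_carrier[of n m t \<psi> gs C b0]] by (intro eq_matI) auto
    then show False using b0 by simp
  qed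
  have card_S: "card (S q) * 2 ^ t \<le> 2 ^ n" if "q \<in> xy_paulis t" for q
  proof (rule card_stabilizing_paulis[OF ent0 \<kappa>, where b = "fst q" and f = "snd q"])
    show "fst q < 2 ^ t" using that by (auto simp: xy_paulis_def)
    show "S q \<subseteq> {..<2 ^ n} \<times> {..<2 ^ n}" using lt by (auto simp: S_def)
    fix a c assume "(a, c) \<in> S q"
    then obtain j where "j \<in> J" "a = a1 j" "c = c1 j" "q = (a3 j, c3 j)" by (auto simp: S_def)
    then show "\<exists>ph. cmod ph = 1 \<and> (\<forall>d<2 ^ n. \<forall>g<2 ^ t. v (b0 * 2 ^ t) d g =
        ph * (wchar n c (d XOR a) * wchar t (snd q) (g XOR fst q) * v (b0 * 2 ^ t) (d XOR a) (g XOR fst q)))"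
      using stab[OF _ col[OF b0(1)], of j] by simp
  qed
  define L where "L = (\<Union>q\<in>xy_paulis t. S q)"
  have fin: "finite (S q)" for q using J by (simp add: S_def)
  have L: "finite L" unfolding L_def using fin finite_xy_paulis by blast
  have "card L * 2 ^ t \<le> (\<Sum>q\<in>xy_paulis t. card (S q)) * 2 ^ t"
    unfolding L_def by (intro mult_right_mono card_UN_le finite_xy_paulis) simp
  also have "\<dots> \<le> (\<Sum>q\<in>xy_paulis t. 2 ^ n)"
    unfolding sum_distrib_right by (intro sum_mono card_S)
  also have "\<dots> \<le> 2 ^ n * 3 ^ t" using card_xy_paulis by simp
  finally have card_L: "card L * 2 ^ t \<le> 2 ^ n * 3 ^ t" .

  define J' where "J' = {j \<in> J. (a3 j, c3 j) \<in> xy_paulis t}"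
  define P where "P = (\<lambda>j. pauli n (a1 j) (c1 j))"
  \<comment> \<open>2^t times the expectation of the gadget Pauli in the magic state; a factor Z
    makes it vanish, which restricts the expansion to \<open>J'\<close>.\<close>
  define \<tau> where "\<tau> = (\<lambda>j. \<Sum>g<2 ^ t. \<Sum>g'<2 ^ t. cnj (tphase t g) * tphase t g' * pauli t (a3 j) (c3 j) $$ (g, g'))"
  have \<tau>: "\<tau> j = 0" if j: "j \<in> J - J'" for j
  proof -
    from j lt[of j] obtain k where k: "bit (c3 j) k" "\<not> bit (a3 j) k" by (auto simp: J'_def xy_paulis_def)
    moreover have "k < t" using k j lt[of j] nat_less_exp_iff_bit[of "c3 j" t] by (auto simp: not_le[symmetric])
    ultimately show ?thesis unfolding \<tau>_def using lt[of j] j by (intro tphase_pauli_vanish) auto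
  qed
  have "povm_elem n m \<psi> gs C b \<in> LinearCombinations.module.span class_ring
      (module_mat TYPE(complex) (2 ^ n) (2 ^ n)) (P ` J')" if b: "b < 2 ^ (n + m)" for b
  proof (rule mat_sum_in_span[where f = "\<lambda>j. coef (b * 2 ^ t) j * \<tau> j"])
    fix d d' :: nat assume d: "d < 2 ^ n" "d' < 2 ^ n"
    have "povm_elem n m \<psi> gs C b $$ (d, d') =
      (\<Sum>g<2 ^ t. cnj (tphase t g) * v (b * 2 ^ t) d g) * cnj (\<Sum>g'<2 ^ t. cnj (tphase t g') * v (b * 2 ^ t) d' g')"
      unfolding povm_elem_index[OF \<psi>(1) C gs b d] contracted_state_def using b d by (simp add: v)
    also have "\<dots> = (\<Sum>g<2 ^ t. \<Sum>g'<2 ^ t. cnj (tphase t g) * tphase t g' * (v (b * 2 ^ t) d g * cnj (v (b * 2 ^ t) d' g')))"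
      unfolding cnj_sum sum_product by (simp add: mult_ac)
    also have "\<dots> = (\<Sum>g<2 ^ t. \<Sum>g'<2 ^ t. \<Sum>j\<in>J. coef (b * 2 ^ t) j * P j $$ (d, d') *
        (cnj (tphase t g) * tphase t g' * pauli t (a3 j) (c3 j) $$ (g, g')))"
    proof (intro sum.cong refl)
      fix g g' assume "g \<in> {..<(2::nat) ^ t}" "g' \<in> {..<(2::nat) ^ t}"
      then have g: "g < 2 ^ t" "g' < 2 ^ t" by auto
      show "cnj (tphase t g) * tphase t g' * (v (b * 2 ^ t) d g * cnj (v (b * 2 ^ t) d' g')) =
        (\<Sum>j\<in>J. coef (b * 2 ^ t) j * P j $$ (d, d') * (cnj (tphase t g) * tphase t g' * pauli t (a3 j) (c3 j) $$ (g, g')))"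
        unfolding expand[OF col[OF b] d g] sum_distrib_left P_def
        by (rule sum.cong[OF refl]) (simp add: mult_ac)
    qed
    also have "\<dots> = (\<Sum>j\<in>J. coef (b * 2 ^ t) j * P j $$ (d, d') * \<tau> j)"
    proof -
      have "(\<Sum>g\<in>A. \<Sum>g'\<in>A. \<Sum>j\<in>X. F g g' j) = (\<Sum>j\<in>X. \<Sum>g\<in>A. \<Sum>g'\<in>A. F g g' j)"
        for F :: "nat \<Rightarrow> nat \<Rightarrow> nat \<Rightarrow> complex" and A X
        by (rule trans[OF sum.cong[OF refl sum.swap] sum.swap])
      then show ?thesis by (simp only: \<tau>_def sum_distrib_left)
    qed
    also have "\<dots> = (\<Sum>j\<in>J'. coef (b * 2 ^ t) j * P j $$ (d, d') * \<tau> j)"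
      by (rule sum.mono_neutral_right[OF J]) (auto simp: J'_def \<tau>)
    finally show "povm_elem n m \<psi> gs C b $$ (d, d') = (\<Sum>j\<in>J'. coef (b * 2 ^ t) j * \<tau> j * P j $$ (d, d'))"
      by (simp add: mult_ac)
  qed (use J povm_elem_carrier in \<open>auto simp: J'_def P_def\<close>)
  then have "s_mu n m \<psi> gs C \<le> card (P ` J')"
    using J by (intro s_mu_le_card) (auto simp: J'_def P_def)
  also have "P ` J' = (\<lambda>(a, c). pauli n a c) ` L"
    by (force simp: P_def J'_def L_def S_def)
  also have "card \<dots> \<le> card L" by (rule card_image_le[OF L])
  finally have "s_mu n m \<psi> gs C * 2 ^ t \<le> card L * 2 ^ t" by simp
  then show ?thesis using card_L by linarith
qed

theorem theorem6:
  fixes n m t :: nat and \<psi> :: "complex vec" and gs C :: "gate list"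
  assumes "t \<le> n" and "t \<le> m"
    and "dim_vec \<psi> = 2 ^ m" and "stabilizer_state m \<psi>"
    and "circuit_ok (n + m) gs" and "num_T gs = t"
    and "clifford_circuit (n + m) C"
    and "\<forall>b < 2 ^ (n + m). proj_state n m t \<psi> gs C b \<noteq> 0\<^sub>m (2 ^ (n + t)) 1 \<longrightarrow>
           max_entangled n t (proj_state n m t \<psi> gs C b)"
  shows "real (s_mu n m \<psi> gs C) \<le> 2 ^ n * (3 / 2) ^ t"
proof -
  have "s_mu n m \<psi> gs C * 2 ^ t \<le> 2 ^ n * 3 ^ t"
    by (rule s_mu_bound) (use assms in auto)
  then have "real (s_mu n m \<psi> gs C * 2 ^ t) \<le> real (2 ^ n * 3 ^ t)" by (rule of_nat_mono)
  then show ?thesis by (simp add: power_divide field_simps)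
qed

end
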